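(* For any skew shape $\lambda/\nu$, we have $\omega(\tilde K_{\lambda/\nu})=J_{\lambda/\nu}$.
   Context: Young diagrams are in English notation. $\omega$ is the algebra involution of the ring $\mathrm{Sym}$ of symmetric functions with $e_k\mapsto h_k$ (elementary to complete homogeneous), extended degree by degree to symmetric power series of unbounded degree. A set-valued tableau of shape $\lambda/\nu$ is a filling of the boxes with nonempty finite sets of positive integers such that the maximum in each box is $\le$ the minimum in the box directly to its right (if present) and $<$ the minimum in the box directly below it (if present). $\tilde K_{\lambda/\nu}=\sum_Tx^T$ over all set-valued tableaux of shape $\lambda/\nu$, where $x^T=\prod_ix_i^{a_i}$ and $a_i$ is the number of boxes whose set contains $i$. It is a symmetric function (of unbounded degree). A weak set-valued tableau of shape $\lambda/\nu$ is a filling of the boxes with finite nonempty multisets of positive integers such that (1) the smallest number in each box is strictly bigger than the largest number in the box directly to the left of it (if present), and (2) the smallest number in each box is greater than or equal to the largest number in the box directly above it (if present). $J_{\lambda/\nu}=\sum_Tx^T$ over all weak set-valued tableaux of shape $\lambda/\nu$, where $x^T=\prod_ix_i^{a_i}$ and $a_i$ is the number of occurrences (with multiplicity) of $i$ in $T$. *)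

theory Defs
  imports "HOL-Library.Poly_Mapping" "HOL-Library.Multiset" "HOL-Library.FuncSet" "HOL-Algebra.Ring"
begin

section \<open>Power series in infinitely many variables\<close>

text \<open>
  The variables are \<open>x\<^sub>1, x\<^sub>2, \<dots>\<close>; a monomial is its exponent vector, and position \<open>i\<close> of the vector
  holds the exponent of \<open>x\<^bsub>i+1\<^esub>\<close>. A power series is its coefficient function.
\<close>

type_synonym monomial = "nat \<Rightarrow>\<^sub>0 nat"

type_synonym pseries = "monomial \<Rightarrow> int"

definition deg :: "monomial \<Rightarrow> nat" where
  "deg m = (\<Sum>i\<in>Poly_Mapping.keys m. Poly_Mapping.lookup m i)"

text \<open>\<^term>\<open>Poly_Mapping.map_key p m\<close> has exponent \<^term>\<open>Poly_Mapping.lookup m (p i)\<close> at position \<open>i\<close>.\<close>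

definition symmetric :: "pseries \<Rightarrow> bool" where
  "symmetric f \<longleftrightarrow> (\<forall>p m. bij p \<longrightarrow> f (Poly_Mapping.map_key p m) = f m)"

definition bounded_degree :: "pseries \<Rightarrow> bool" where
  "bounded_degree f \<longleftrightarrow> (\<exists>N. \<forall>m. f m \<noteq> 0 \<longrightarrow> deg m \<le> N)"

definition homogeneous_part :: "nat \<Rightarrow> pseries \<Rightarrow> pseries" where
  "homogeneous_part d f = (\<lambda>m. if deg m = d then f m else 0)"

section \<open>The ring of symmetric functions and the involution\<close>

definition Sym :: "pseries ring" where
  "Sym = \<lparr>carrier = {f. symmetric f \<and> bounded_degree f},
          monoid.mult = (\<lambda>f g m. \<Sum>(a, b)\<in>{(a, b). a + b = m}. f a * g b),
          one = (\<lambda>m. if m = 0 then 1 else 0),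
          zero = (\<lambda>m. 0),
          add = (\<lambda>f g m. f m + g m)\<rparr>"

definition elem_sym :: "nat \<Rightarrow> pseries" where
  "elem_sym k = (\<lambda>m. if deg m = k \<and> (\<forall>i. Poly_Mapping.lookup m i \<le> 1) then 1 else 0)"

definition complete_sym :: "nat \<Rightarrow> pseries" where
  "complete_sym k = (\<lambda>m. if deg m = k then 1 else 0)"

text \<open>
  Algebra homomorphisms are ring homomorphisms, as the coefficients are integers. The condition
  \<^term>\<open>\<phi> \<in> extensional (carrier Sym)\<close> only fixes the irrelevant values outside \<^term>\<open>Sym\<close>, so that the
  description determines a unique HOL function.
\<close>

definition omega_Sym :: "pseries \<Rightarrow> pseries" where
  "omega_Sym = (THE \<phi>. \<phi> \<in> ring_hom Sym Sym \<and> \<phi> \<in> extensional (carrier Sym) \<and>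
     (\<forall>f\<in>carrier Sym. \<phi> (\<phi> f) = f) \<and>
     (\<forall>k. \<phi> (elem_sym k) = complete_sym k))"

text \<open>
  The extension to unbounded degree sends a series to the sum of the images of its homogeneous
  parts. As the involution preserves degree, only finitely many of these images (at most one)
  contribute to the coefficient of a given monomial.
\<close>

definition omega :: "pseries \<Rightarrow> pseries" where
  "omega f = (\<lambda>m. Sum_any (\<lambda>d. omega_Sym (homogeneous_part d f) m))"

section \<open>Skew shapes and tableaux\<close>

definition is_partition :: "nat list \<Rightarrow> bool" where
  "is_partition ps \<longleftrightarrow> sorted_wrt (\<ge>) ps \<and> 0 \<notin> set ps"

text \<open>Boxes are pairs (row, column), counted from 0, with rows going down (English notation).\<close>

definition diagram :: "nat list \<Rightarrow> (nat \<times> nat) set" where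
  "diagram ps = {(i, j). i < length ps \<and> j < ps ! i}"

definition skew :: "nat list \<Rightarrow> nat list \<Rightarrow> (nat \<times> nat) set" where
  "skew lam nu = diagram lam - diagram nu"

text \<open>
  Fillings are total functions, normalised to be empty outside the shape so that each filling is
  counted once.
\<close>

definition set_valued_tableau :: "(nat \<times> nat) set \<Rightarrow> (nat \<times> nat \<Rightarrow> nat set) \<Rightarrow> bool" where
  "set_valued_tableau S T \<longleftrightarrow>
     (\<forall>b. b \<notin> S \<longrightarrow> T b = {}) \<and>
     (\<forall>b\<in>S. finite (T b) \<and> T b \<noteq> {} \<and> (\<forall>a\<in>T b. a > 0)) \<and>
     (\<forall>i j. (i, j) \<in> S \<and> (i, Suc j) \<in> S \<longrightarrow> Max (T (i, j)) \<le> Min (T (i, Suc j))) \<and>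
     (\<forall>i j. (i, j) \<in> S \<and> (Suc i, j) \<in> S \<longrightarrow> Max (T (i, j)) < Min (T (Suc i, j)))"

definition weak_set_valued_tableau :: "(nat \<times> nat) set \<Rightarrow> (nat \<times> nat \<Rightarrow> nat multiset) \<Rightarrow> bool" where
  "weak_set_valued_tableau S T \<longleftrightarrow>
     (\<forall>b. b \<notin> S \<longrightarrow> T b = {#}) \<and>
     (\<forall>b\<in>S. T b \<noteq> {#} \<and> (\<forall>a\<in>#T b. a > 0)) \<and>
     (\<forall>i j. (i, j) \<in> S \<and> (i, Suc j) \<in> S \<longrightarrow>
        Max (set_mset (T (i, j))) < Min (set_mset (T (i, Suc j)))) \<and>
     (\<forall>i j. (i, j) \<in> S \<and> (Suc i, j) \<in> S \<longrightarrow>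
        Max (set_mset (T (i, j))) \<le> Min (set_mset (T (Suc i, j))))"

text \<open>
  The coefficient of \<open>m\<close> is the number of tableaux \<open>T\<close> with \<open>x\<^sup>T = m\<close>. There are finitely many of
  them, as the entries of \<open>T\<close> and their multiplicities are bounded by \<open>m\<close>.
\<close>

definition K_tilde :: "nat list \<Rightarrow> nat list \<Rightarrow> pseries" where
  "K_tilde lam nu = (\<lambda>m. int (card {T. set_valued_tableau (skew lam nu) T \<and>
     (\<forall>i. Poly_Mapping.lookup m i = card {b \<in> skew lam nu. Suc i \<in> T b})}))"

definition J_weak :: "nat list \<Rightarrow> nat list \<Rightarrow> pseries" where
  "J_weak lam nu = (\<lambda>m. int (card {T. weak_set_valued_tableau (skew lam nu) T \<and>
     (\<forall>i. Poly_Mapping.lookup m i = (\<Sum>b\<in>skew lam nu. count (T b) (Suc i)))}))"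

end

theory Submission
  imports Defs "HOL-Combinatorics.Permutations"
begin

text \<open>
  On coefficients, \<open>\<omega>\<close> is the signed refinement
  \<open>(\<omega> f)(n\<^sub>1, \<dots>, n\<^sub>r) = \<Sum> (-1)\<^bsup>|n| - \<ell>(\<alpha>)\<^esup> f(\<alpha>)\<close>, where \<open>\<alpha>\<close> runs over the concatenations of compositions
  of the \<open>n\<^sub>i\<close>. In each variable it inverts, at \<open>-x\<close>, the multiplicative map extracting the exponents of
  that variable, so it is a ring homomorphism; the elementary symmetric functions generate, so it is the only
  candidate.

  Tableaux are built letter by letter: let \<open>u\<^sub>d\<close> add a box on diagonal \<open>d\<close>, or keep a corner that is
  already there. In a set-valued tableau the occurrences of one letter are inserted along increasing diagonals,
  which gives the operator \<open>U(x) = \<Prod>(1 + x u\<^sub>d)\<close>; in a weak one they are inserted with multiplicity along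
  decreasing diagonals, which gives \<open>\<Prod>(1 - x u\<^sub>d)\<^bsup>-1\<^esup> = U(-x)\<^bsup>-1\<^esup>\<close>. The relations
  \<open>u\<^sub>d\<^sup>2 = u\<^sub>d\<close>, \<open>u\<^sub>d u\<^bsub>d+1\<^esub> u\<^sub>d = 0 = u\<^bsub>d+1\<^esub> u\<^sub>d u\<^bsub>d+1\<^esub>\<close> and \<open>u\<^sub>c u\<^sub>d = u\<^sub>d u\<^sub>c\<close> for \<open>|c - d| \<ge> 2\<close> make
  the \<open>U(x)\<close> commute, hence the set-valued series is symmetric, and inverting \<open>U(-x)\<close> in each variable is
  exactly \<open>\<omega>\<close>.
\<close>

section \<open>The involution on functions of exponent lists\<close>

text \<open>The insertion orders come from the tableau conditions. In a set-valued tableau a letter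
  may repeat along a row but not down a column: it meets every diagonal at most once, and left
  occurrences precede right ones, so \<open>j - i\<close> grows. In a weak tableau a letter may
  repeat down a column and inside a box but not along a row: upper occurrences precede lower ones,
  so \<open>j - i\<close> drops, and repetition inside a box replaces \<open>1 + x u_d\<close> by a
  geometric series. The same factors thus appear inverted, at \<open>-x\<close>, and in opposite
  order, which is exactly how a product is inverted. Symmetry of the set-valued series is needed
  before the involution can be evaluated at all: the refinement formula depends on a chosen list of
  exponents and is well defined on monomials only for inputs that ignore order and zeros.
  \<open>sym_list\<close> records that freedom. Lists are used because both the involution and the
  product of series can then be handled one variable at a time.\<close>

definition slice :: "nat \<Rightarrow> (nat list \<Rightarrow> int) \<Rightarrow> nat list \<Rightarrow> int" where
  "slice k \<phi> as = \<phi> (k # as)"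

text \<open>\<open>signed_comp n \<phi> bs\<close> sums \<open>(-1)\<^bsup>n - length \<alpha>\<^esup> \<phi> (\<alpha> @ bs)\<close> over the compositions \<open>\<alpha>\<close> of \<open>n\<close>.\<close>

fun signed_comp :: "nat \<Rightarrow> (nat list \<Rightarrow> int) \<Rightarrow> nat list \<Rightarrow> int" where
  "signed_comp 0 \<phi> = \<phi>"
| "signed_comp (Suc n) \<phi> = (\<lambda>bs. \<Sum>k\<le>n. (-1) ^ k * signed_comp (n - k) (slice (Suc k) \<phi>) bs)"

fun omega_list :: "(nat list \<Rightarrow> int) \<Rightarrow> nat list \<Rightarrow> int" where
  "omega_list \<phi> [] = \<phi> []"
| "omega_list \<phi> (n # ns) = omega_list (signed_comp n \<phi>) ns"

fun list_conv :: "(nat list \<Rightarrow> int) \<Rightarrow> (nat list \<Rightarrow> int) \<Rightarrow> nat list \<Rightarrow> int" where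
  "list_conv \<phi> \<psi> [] = \<phi> [] * \<psi> []"
| "list_conv \<phi> \<psi> (n # ns) = (\<Sum>k\<le>n. list_conv (slice k \<phi>) (slice (n - k) \<psi>) ns)"

definition sym_list :: "(nat list \<Rightarrow> int) \<Rightarrow> bool" where
  "sym_list \<phi> \<longleftrightarrow> (\<forall>as bs. mset as = mset bs \<longrightarrow> \<phi> as = \<phi> bs) \<and> (\<forall>as. \<phi> (0 # as) = \<phi> as)"

lemma slice_0: "sym_list \<phi> \<Longrightarrow> slice 0 \<phi> = \<phi>"
  unfolding sym_list_def slice_def by blast

lemma slice_commute:
  assumes "sym_list \<phi>"
  shows "slice j (slice k \<phi>) = slice k (slice j \<phi>)"
proof
  fix as
  have "mset (k # j # as) = mset (j # k # as)" by simp
  then show "slice j (slice k \<phi>) as = slice k (slice j \<phi>) as"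
    using assms unfolding sym_list_def slice_def by blast
qed

lemma sym_list_slice: "sym_list \<phi> \<Longrightarrow> sym_list (slice k \<phi>)"
  using slice_commute[of \<phi> 0 k] slice_0[of \<phi>]
  unfolding sym_list_def slice_def fun_eq_iff by (metis mset.simps(2))

lemma slice_sum: "slice k (\<lambda>as. \<Sum>i\<in>I. c i * \<phi> i as) = (\<lambda>as. \<Sum>i\<in>I. c i * slice k (\<phi> i) as)"
  by (simp add: slice_def fun_eq_iff)

lemma signed_comp_sum:
  "signed_comp n (\<lambda>as. \<Sum>i\<in>I. c i * \<phi> i as) = (\<lambda>bs. \<Sum>i\<in>I. c i * signed_comp n (\<phi> i) bs)"
proof (induction n arbitrary: \<phi> rule: less_induct)
  case (less n)
  show ?case
  proof (cases n)
    case (Suc m)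
    have sc: "signed_comp (m - k) (slice (Suc k) (\<lambda>as. \<Sum>i\<in>I. c i * \<phi> i as)) =
        (\<lambda>bs. \<Sum>i\<in>I. c i * signed_comp (m - k) (slice (Suc k) (\<phi> i)) bs)" for k
      unfolding slice_sum by (rule less.IH) (use Suc in auto)
    show ?thesis
      unfolding Suc signed_comp.simps sc sum_distrib_left
      by (rule ext, subst sum.swap) (simp add: ac_simps)
  qed simp
qed

lemma omega_list_sum:
  "omega_list (\<lambda>as. \<Sum>i\<in>I. c i * \<phi> i as) ns = (\<Sum>i\<in>I. c i * omega_list (\<phi> i) ns)"
  by (induction ns arbitrary: \<phi>) (simp_all add: signed_comp_sum)

lemma signed_comp_zero: "signed_comp n (\<lambda>as. 0) = (\<lambda>as. 0)"
  using signed_comp_sum[where I = "{}"] by simp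

lemma omega_list_zero: "omega_list (\<lambda>as. 0) ns = 0"
  by (induction ns) (simp_all add: signed_comp_zero)

lemma omega_list_add: "omega_list (\<lambda>as. \<phi> as + \<psi> as) ns = omega_list \<phi> ns + omega_list \<psi> ns"
  using omega_list_sum[where I = "{True, False}" and c = "\<lambda>_. 1" and \<phi> = "\<lambda>b. if b then \<phi> else \<psi>"] by simp

lemma sym_list_sum:
  "(\<And>i. i \<in> I \<Longrightarrow> sym_list (\<phi> i)) \<Longrightarrow> sym_list (\<lambda>as. \<Sum>i\<in>I. c i * \<phi> i as)"
  unfolding sym_list_def by (intro conjI allI impI sum.cong refl arg_cong2[of _ _ _ _ "(*)"]) blast+

lemma sym_list_signed_comp: "sym_list \<phi> \<Longrightarrow> sym_list (signed_comp n \<phi>)"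
proof (induction n arbitrary: \<phi> rule: less_induct)
  case (less n)
  show ?case
  proof (cases n)
    case (Suc m)
    show ?thesis
      unfolding Suc signed_comp.simps
      by (intro sym_list_sum less.IH sym_list_slice less.prems) (use Suc in auto)
  qed (use less.prems in simp)
qed

lemma slice_signed_comp:
  "sym_list \<phi> \<Longrightarrow> slice j (signed_comp n \<phi>) = signed_comp n (slice j \<phi>)"
proof (induction n arbitrary: \<phi> rule: less_induct)
  case (less n)
  show ?case
  proof (cases n)
    case (Suc m)
    have "slice j (signed_comp (m - k) (slice (Suc k) \<phi>)) = signed_comp (m - k) (slice (Suc k) (slice j \<phi>))" for k
      using less.IH[of "m - k" "slice (Suc k) \<phi>"] less.prems Suc
      by (simp add: sym_list_slice slice_commute)
    then show ?thesis by (simp add: Suc slice_sum)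
  qed simp
qed

lemma signed_comp_commute:
  "sym_list \<phi> \<Longrightarrow> signed_comp n (signed_comp m \<phi>) = signed_comp m (signed_comp n \<phi>)"
proof (induction m arbitrary: \<phi> rule: less_induct)
  case (less m)
  show ?case
  proof (cases m)
    case (Suc l)
    have "signed_comp n (signed_comp (l - k) (slice (Suc k) \<phi>)) =
        signed_comp (l - k) (slice (Suc k) (signed_comp n \<phi>))" for k
      using less.IH[of "l - k" "slice (Suc k) \<phi>"] less.prems Suc
      by (simp add: sym_list_slice slice_signed_comp)
    then show ?thesis by (simp add: Suc signed_comp_sum)
  qed simp
qed

text \<open>The recursion of \<open>signed_comp\<close> with all terms on one side: its series
  inverts the series of slices at \<open>-x\<close>. The term \<open>k = 0\<close> relies on
  \<open>slice 0 \<phi> = \<phi>\<close>.\<close>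

lemma signed_comp_left_inverse:
  assumes "sym_list \<phi>"
  shows "(\<Sum>k\<le>n. (-1) ^ k * signed_comp (n - k) (slice k \<phi>) as) = (if n = 0 then \<phi> as else 0)"
proof (cases n)
  case (Suc m)
  then show ?thesis
    using assms by (simp add: sum.atMost_Suc_shift slice_0 sum_negf del: sum.atMost_Suc)
qed (use assms in \<open>simp add: slice_0\<close>)

text \<open>Slices commute with \<open>signed_comp\<close>, so the inverse is two-sided.\<close>

lemma signed_comp_inverse:
  assumes "sym_list \<phi>"
  shows "(\<Sum>k\<le>n. (-1) ^ k * slice k (signed_comp (n - k) \<phi>) as) = (if n = 0 then \<phi> as else 0)"
  using signed_comp_left_inverse[OF assms] by (simp add: slice_signed_comp assms)

text \<open>The operators \<open>signed_comp n\<close> commute, so the entries may be consumed in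
  any order; \<open>signed_comp 0\<close> is the identity, so zeros disappear.\<close>

lemma sym_list_omega_list:
  assumes "sym_list \<phi>"
  shows "sym_list (omega_list \<phi>)"
proof -
  have *: "omega_list \<phi> (ms @ k # ns) = omega_list \<phi> (k # ms @ ns)" if "sym_list \<phi>" for \<phi> ms k ns
    using that
  proof (induction ms arbitrary: \<phi>)
    case (Cons m ms)
    then show ?case by (simp add: sym_list_signed_comp signed_comp_commute)
  qed simp
  have "omega_list \<phi> as = omega_list \<phi> bs" if "mset as = mset bs" for as bs
    using that assms
  proof (induction as arbitrary: bs \<phi>)
    case (Cons a as)
    from Cons.prems(1) have "a \<in> set bs" by (metis list.set_intros(1) set_mset_mset)
    then obtain xs ys where bs: "bs = xs @ a # ys" by (meson split_list)
    with Cons.prems have "mset as = mset (xs @ ys)" by simp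
    with Cons.IH[OF this, of "signed_comp a \<phi>"] Cons.prems show ?case
      by (simp add: bs * sym_list_signed_comp)
  qed simp
  then show ?thesis unfolding sym_list_def by (metis omega_list.simps(2) signed_comp.simps(1))
qed

lemma slice_omega_list: "slice k (omega_list \<phi>) = omega_list (signed_comp k \<phi>)"
  by (simp add: slice_def fun_eq_iff)

text \<open>The dual of \<open>slice_omega_list\<close>: \<open>omega_list\<close> exchanges
  \<open>slice\<close> and \<open>signed_comp\<close>, since inverting at \<open>-x\<close> twice
  restores a series. This drives the involution property.\<close>

lemma signed_comp_omega_list:
  "sym_list \<phi> \<Longrightarrow> signed_comp n (omega_list \<phi>) = omega_list (slice n \<phi>)"
proof (induction n arbitrary: \<phi> rule: less_induct)
  case (less n)
  show ?case
  proof (cases n)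
    case 0
    then show ?thesis using less.prems by (simp add: slice_0)
  next
    case (Suc m)
    have IH: "signed_comp (m - k) (slice (Suc k) (omega_list \<phi>)) =
        omega_list (slice (m - k) (signed_comp (Suc k) \<phi>))" for k
      unfolding slice_omega_list using less.prems Suc
      by (intro less.IH) (auto intro!: sym_list_signed_comp simp del: signed_comp.simps)
    \<comment> \<open>This is \<open>signed_comp_inverse\<close> at \<open>Suc m\<close> read
      backwards: replacing \<open>k\<close> by \<open>m - k\<close> costs a sign
      \<open>(-1)^m\<close>, which cancels against that of the isolated term
      \<open>k = Suc m\<close>.\<close>
    have "(\<Sum>k\<le>m. (-1) ^ k * slice (m - k) (signed_comp (Suc k) \<phi>) as) = slice (Suc m) \<phi> as" for as
    proof -
      have "0 = (\<Sum>k\<le>Suc m. (-1) ^ k * slice k (signed_comp (Suc m - k) \<phi>) as)"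
        using signed_comp_inverse[OF less.prems, of "Suc m" as] by simp
      also have "\<dots> = (\<Sum>k\<le>m. (-1) ^ k * slice k (signed_comp (Suc m - k) \<phi>) as)
          + (-1) ^ Suc m * slice (Suc m) \<phi> as" by simp
      also have "(\<Sum>k\<le>m. (-1) ^ k * slice k (signed_comp (Suc m - k) \<phi>) as) =
          (\<Sum>k\<le>m. (-1) ^ m * ((-1) ^ k * slice (m - k) (signed_comp (Suc k) \<phi>) as))"
        by (rule sum.reindex_bij_witness[of _ "\<lambda>k. m - k" "\<lambda>k. m - k"])
          (auto simp: Suc_diff_le minus_one_power_iff simp del: signed_comp.simps)
      finally have "(-1) ^ m * (\<Sum>k\<le>m. (-1) ^ k * slice (m - k) (signed_comp (Suc k) \<phi>) as) =
          (-1) ^ m * slice (Suc m) \<phi> as"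
        unfolding sum_distrib_left[symmetric] by simp
      then show ?thesis by simp
    qed
    then have "slice (Suc m) \<phi> = (\<lambda>as. \<Sum>k\<le>m. (-1) ^ k * slice (m - k) (signed_comp (Suc k) \<phi>) as)"
      by (simp add: fun_eq_iff)
    then show ?thesis
      unfolding Suc signed_comp.simps(2)[of m "omega_list \<phi>"] IH by (simp add: omega_list_sum fun_eq_iff del: signed_comp.simps)
  qed
qed

lemma omega_list_omega_list: "sym_list \<phi> \<Longrightarrow> omega_list (omega_list \<phi>) ns = \<phi> ns"
proof (induction ns arbitrary: \<phi>)
  case (Cons n ns)
  then show ?case by (simp add: signed_comp_omega_list sym_list_slice) (simp add: slice_def)
qed simp

section \<open>Multiplicativity of the involution\<close>

lemma slice_list_conv:
  "slice n (list_conv \<phi> \<psi>) = (\<lambda>as. \<Sum>k\<le>n. list_conv (slice k \<phi>) (slice (n - k) \<psi>) as)"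
  by (simp add: slice_def fun_eq_iff)

lemma list_conv_sum:
  "list_conv (\<lambda>as. \<Sum>i\<in>I. c i * \<phi> i as) (\<lambda>as. \<Sum>j\<in>J. d j * \<psi> j as) ns =
    (\<Sum>(i, j)\<in>I \<times> J. c i * d j * list_conv (\<phi> i) (\<psi> j) ns)"
proof (induction ns arbitrary: \<phi> \<psi>)
  case Nil
  then show ?case by (simp add: sum_product sum.cartesian_product ac_simps)
next
  case (Cons n ns)
  show ?case
    by (simp add: slice_sum Cons.IH sum_distrib_left case_prod_unfold) (rule sum.swap)
qed

lemma list_conv_0: "list_conv (\<lambda>as. 0) \<psi> ns = 0" "list_conv \<phi> (\<lambda>as. 0) ns = 0"
  using list_conv_sum[where I = "{}" and J = "{0::nat}" and d = "\<lambda>_. 1" and \<psi> = "\<lambda>_. \<psi>"]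
    list_conv_sum[where J = "{}" and I = "{0::nat}" and c = "\<lambda>_. 1" and \<phi> = "\<lambda>_. \<phi>"] by simp_all

text \<open>Both sides sum over all ways to write \<open>n\<close> as \<open>p + i + q + j\<close>,
  grouped by \<open>p + q\<close> on the left and by \<open>p + i\<close> on the right.\<close>

lemma quadruple_sum:
  fixes h :: "nat \<Rightarrow> nat \<Rightarrow> nat \<Rightarrow> nat \<Rightarrow> int"
  shows "(\<Sum>k\<le>n. \<Sum>p\<le>k. \<Sum>i\<le>n - k. h p i (k - p) (n - k - i)) =
    (\<Sum>a\<le>n. \<Sum>p\<le>a. \<Sum>q\<le>n - a. h p (a - p) q (n - a - q))"
proof -
  have "(\<Sum>k\<le>n. \<Sum>p\<le>k. \<Sum>i\<le>n - k. h p i (k - p) (n - k - i)) =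
      (\<Sum>(k, p, i)\<in>(SIGMA k:{..n}. {..k} \<times> {..n - k}). h p i (k - p) (n - k - i))"
    by (simp add: sum.Sigma sum.cartesian_product)
  also have "\<dots> = (\<Sum>(a, p, q)\<in>(SIGMA a:{..n}. {..a} \<times> {..n - a}). h p (a - p) q (n - a - q))"
    by (rule sum.reindex_bij_witness[of _ "\<lambda>(a, p, q). (p + q, p, a - p)" "\<lambda>(k, p, i). (p + i, p, k - p)"])
      (auto simp: add.commute)
  also have "\<dots> = (\<Sum>a\<le>n. \<Sum>p\<le>a. \<Sum>q\<le>n - a. h p (a - p) q (n - a - q))"
    by (simp add: sum.Sigma sum.cartesian_product)
  finally show ?thesis .
qed

text \<open>On generating functions, \<^const>\<open>slice\<close> is multiplicative and \<^const>\<open>signed_comp\<close> is its inverse at \<open>-x\<close>.\<close>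

lemma signed_comp_list_conv:
  assumes "sym_list \<phi>" "sym_list \<psi>"
  shows "signed_comp n (list_conv \<phi> \<psi>) as =
    (\<Sum>k\<le>n. list_conv (signed_comp k \<phi>) (signed_comp (n - k) \<psi>) as)"
  using assms
proof (induction n arbitrary: \<phi> \<psi> rule: less_induct)
  case (less n)
  show ?case
  proof (cases n)
    case (Suc m)
    \<comment> \<open>\<open>p\<close> and \<open>q\<close> are the parts split off from the two
      factors, \<open>i\<close> and \<open>j\<close> what is left of them. Grouping by
      \<open>p + q\<close> gives the recursion for the product; grouping by \<open>p + i\<close>
      gives products of two inverse relations, one of which vanishes because
      \<open>n > 0\<close>.\<close>
    define h where "h p i q j = (-1) ^ (p + q) *
      list_conv (signed_comp i (slice p \<phi>)) (signed_comp j (slice q \<psi>)) as" for p i q j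
    let ?F = "\<lambda>k. \<Sum>p\<le>k. \<Sum>i\<le>n - k. h p i (k - p) (n - k - i)"
    have IH: "signed_comp (m - k) (slice (Suc k) (list_conv \<phi> \<psi>)) as = (-1) ^ Suc k * ?F (Suc k)" for k
    proof -
      have "signed_comp (m - k) (\<lambda>as. \<Sum>p\<le>Suc k. 1 * list_conv (slice p \<phi>) (slice (Suc k - p) \<psi>) as) as =
          (\<Sum>p\<le>Suc k. \<Sum>i\<le>m - k. list_conv (signed_comp i (slice p \<phi>))
            (signed_comp (m - k - i) (slice (Suc k - p) \<psi>)) as)"
        unfolding signed_comp_sum using less Suc by (simp add: sym_list_slice del: sum.atMost_Suc)
      also have "\<dots> = (-1) ^ Suc k * ?F (Suc k)"
        unfolding sum_distrib_left h_def by (intro sum.cong refl) (auto simp: Suc minus_one_power_iff)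
      finally show ?thesis by (simp add: slice_list_conv del: sum.atMost_Suc)
    qed
    have "(\<Sum>k\<le>n. ?F k) = (\<Sum>a\<le>n. \<Sum>p\<le>a. \<Sum>q\<le>n - a. h p (a - p) q (n - a - q))"
      by (rule quadruple_sum)
    also have "\<dots> = (\<Sum>a\<le>n. list_conv
        (\<lambda>as. \<Sum>p\<le>a. (-1) ^ p * signed_comp (a - p) (slice p \<phi>) as)
        (\<lambda>as. \<Sum>q\<le>n - a. (-1) ^ q * signed_comp (n - a - q) (slice q \<psi>) as) as)"
      unfolding list_conv_sum h_def
      by (simp add: sum.cartesian_product power_add)
    also have "\<dots> = (\<Sum>a\<le>n. list_conv (\<lambda>as. if a = 0 then \<phi> as else 0) (\<lambda>as. if n - a = 0 then \<psi> as else 0) as)"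
      by (simp only: signed_comp_left_inverse less.prems)
    also have "\<dots> = (\<Sum>a\<le>n. 0)"
    proof (intro sum.cong refl)
      fix a
      show "list_conv (\<lambda>as. if a = 0 then \<phi> as else 0) (\<lambda>as. if n - a = 0 then \<psi> as else 0) as = 0"
        by (cases "a = 0") (use Suc in \<open>simp_all add: list_conv_0\<close>)
    qed
    finally have "?F 0 + (\<Sum>k\<le>m. ?F (Suc k)) = 0"
      by (simp add: Suc sum.atMost_Suc_shift del: sum.atMost_Suc)
    moreover have "?F 0 = (\<Sum>k\<le>n. list_conv (signed_comp k \<phi>) (signed_comp (n - k) \<psi>) as)"
      by (simp add: h_def slice_0 less.prems)
    moreover have "signed_comp n (list_conv \<phi> \<psi>) as = - (\<Sum>k\<le>m. ?F (Suc k))"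
      by (simp add: Suc IH sum_negf[symmetric] mult.assoc[symmetric] power_add[symmetric]
          del: sum.atMost_Suc)
    ultimately show ?thesis by simp
  qed simp
qed

lemma omega_list_conv:
  "sym_list \<phi> \<Longrightarrow> sym_list \<psi> \<Longrightarrow>
    omega_list (list_conv \<phi> \<psi>) ns = list_conv (omega_list \<phi>) (omega_list \<psi>) ns"
proof (induction ns arbitrary: \<phi> \<psi>)
  case (Cons n ns)
  have "signed_comp n (list_conv \<phi> \<psi>) =
      (\<lambda>as. \<Sum>k\<le>n. 1 * list_conv (signed_comp k \<phi>) (signed_comp (n - k) \<psi>) as)"
    using Cons.prems by (simp add: signed_comp_list_conv fun_eq_iff)
  then show ?case
    using Cons by (simp only: omega_list.simps omega_list_sum list_conv.simps slice_omega_list)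
      (simp add: sym_list_signed_comp)
qed simp

text \<open>Refining an exponent keeps the total, so degrees are preserved; the extension of the
  involution degree by degree rests on this.\<close>

lemma signed_comp_graded:
  "signed_comp n (\<lambda>as. if sum_list as = d then \<phi> as else 0) =
    (\<lambda>as. if n + sum_list as = d then signed_comp n \<phi> as else 0)"
proof (induction n arbitrary: \<phi> d rule: less_induct)
  case (less n)
  show ?case
  proof (cases n)
    case (Suc m)
    let ?\<phi> = "\<lambda>as. if sum_list as = d then \<phi> as else 0"
    have "signed_comp (m - k) (slice (Suc k) ?\<phi>) =
      (\<lambda>as. if Suc m + sum_list as = d then signed_comp (m - k) (slice (Suc k) \<phi>) as else 0)" if "k \<le> m" for k
    proof (cases "Suc k \<le> d")
      case True
      have "slice (Suc k) ?\<phi> = (\<lambda>as. if sum_list as = d - Suc k then slice (Suc k) \<phi> as else 0)"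
        using True by (auto simp: slice_def fun_eq_iff)
      moreover have "m - k + sum_list as = d - Suc k \<longleftrightarrow> Suc m + sum_list as = d" for as
        using True that by auto
      ultimately show ?thesis
        using less.IH[of "m - k" "d - Suc k" "slice (Suc k) \<phi>"] by (simp add: Suc)
    next
      case False
      have "slice (Suc k) ?\<phi> = (\<lambda>as. 0)"
        using False by (auto simp: slice_def fun_eq_iff)
      then show ?thesis using False that by (auto simp: signed_comp_zero)
    qed
    then show ?thesis by (simp add: Suc fun_eq_iff)
  next
    case 0
    show ?thesis unfolding 0 by (simp add: fun_eq_iff)
  qed
qed

lemma omega_list_graded:
  "omega_list (\<lambda>as. if sum_list as = d then \<phi> as else 0) ns = (if sum_list ns = d then omega_list \<phi> ns else 0)"
proof (induction ns arbitrary: \<phi> d)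
  case (Cons n ns)
  show ?case
  proof (cases "n \<le> d")
    case True
    then have "n + sum_list as = d \<longleftrightarrow> sum_list as = d - n" for as :: "nat list" by auto
    then show ?thesis by (simp add: signed_comp_graded Cons.IH)
  next
    case False
    have "signed_comp n (\<lambda>as. if sum_list as = d then \<phi> as else 0) = (\<lambda>as. 0)"
      using False by (auto simp: signed_comp_graded fun_eq_iff)
    then show ?thesis using False by (simp add: omega_list_zero)
  qed
qed simp

definition elem_list :: "nat \<Rightarrow> nat list \<Rightarrow> int" where
  "elem_list k as = (if sum_list as = k \<and> (\<forall>a\<in>set as. a \<le> 1) then 1 else 0)"

text \<open>Among the refinements of \<open>n\<close> only the one into ones meets the support of
  \<open>elem_list\<close>, and its sign is \<open>+1\<close>.\<close>

lemma signed_comp_elem_list: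
  "signed_comp n (elem_list k) = (if n \<le> k then elem_list (k - n) else (\<lambda>as. 0))"
proof (induction n arbitrary: k)
  case (Suc n)
  have "slice (Suc i) (elem_list k) = (\<lambda>as. 0)" if "i \<noteq> 0" for i
    using that by (auto simp: slice_def elem_list_def fun_eq_iff)
  then have "signed_comp (Suc n) (elem_list k) = signed_comp n (slice 1 (elem_list k))"
    by (simp add: sum.atMost_shift signed_comp_zero)
  moreover have "slice 1 (elem_list k) = (if k = 0 then (\<lambda>as. 0) else elem_list (k - 1))"
    by (auto simp: slice_def elem_list_def fun_eq_iff)
  ultimately show ?case
    using Suc.IH[of "k - 1"] by (cases k) (simp_all add: signed_comp_zero del: signed_comp.simps)
qed simp

lemma omega_elem_list: "omega_list (elem_list k) ns = (if sum_list ns = k then 1 else 0)"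
proof (induction ns arbitrary: k)
  case Nil
  then show ?case by (simp add: elem_list_def)
next
  case (Cons n ns)
  then show ?case by (auto simp: signed_comp_elem_list omega_list_zero)
qed

section \<open>Operators adding boxes along diagonals\<close>
definition order_ideal :: "(nat \<times> nat) set \<Rightarrow> bool" where
  "order_ideal A \<longleftrightarrow> (\<forall>i j i' j'. (i, j) \<in> A \<longrightarrow> i' \<le> i \<longrightarrow> j' \<le> j \<longrightarrow> (i', j') \<in> A)"

lemma order_idealD: "order_ideal A \<Longrightarrow> (i, j) \<in> A \<Longrightarrow> i' \<le> i \<Longrightarrow> j' \<le> j \<Longrightarrow> (i', j') \<in> A"
  unfolding order_ideal_def by blast

text \<open>Stated for indexed combinations, the form in which \<open>signed_comp\<close> produces
  sums; the index type is fixed because a predicate cannot quantify over types.\<close>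

definition linear_op :: "(('s \<Rightarrow> int) \<Rightarrow> 's \<Rightarrow> int) \<Rightarrow> bool" where
  "linear_op T \<longleftrightarrow> (\<forall>(I :: nat set) c F. T (\<lambda>B. \<Sum>i\<in>I. c i * F i B) = (\<lambda>A. \<Sum>i\<in>I. c i * T (F i) A))"

lemma linear_opD: "linear_op T \<Longrightarrow> T (\<lambda>B. \<Sum>i\<in>I. c i * F i B) A = (\<Sum>i\<in>(I :: nat set). c i * T (F i) A)"
  unfolding linear_op_def by metis

lemma linear_op_add: "linear_op T \<Longrightarrow> T (\<lambda>B. f B + g B) A = T f A + T g A"
  using linear_opD[where I = "{0, 1}" and c = "\<lambda>_. 1" and F = "\<lambda>i. if i = 0 then f else g"] by simp

lemma linear_op_zero: "linear_op T \<Longrightarrow> T (\<lambda>B. 0) A = 0"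
  using linear_opD[where I = "{}"] by simp

lemma linear_op_compose: "linear_op T \<Longrightarrow> linear_op U \<Longrightarrow> linear_op (\<lambda>g. T (U g))"
  unfolding linear_op_def by simp

lemma linear_op_comb:
  assumes "\<And>i. i \<in> J \<Longrightarrow> linear_op (T i)"
  shows "linear_op (\<lambda>g A. \<Sum>i\<in>J. c i * T i g A)"
  unfolding linear_op_def
proof (intro allI ext)
  fix I :: "nat set" and d F A
  have "(\<Sum>i\<in>J. c i * T i (\<lambda>B. \<Sum>k\<in>I. d k * F k B) A) = (\<Sum>i\<in>J. \<Sum>k\<in>I. d k * (c i * T i (F k) A))"
    using assms by (intro sum.cong refl) (simp add: linear_opD sum_distrib_left ac_simps)
  also have "\<dots> = (\<Sum>k\<in>I. d k * (\<Sum>i\<in>J. c i * T i (F k) A))"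
    by (subst sum.swap) (simp add: sum_distrib_left)
  finally show "(\<Sum>i\<in>J. c i * T i (\<lambda>B. \<Sum>k\<in>I. d k * F k B) A) = (\<Sum>k\<in>I. d k * (\<Sum>i\<in>J. c i * T i (F k) A))" .
qed

text \<open>\<open>signed_comp\<close> acts on the list argument and \<open>T\<close> on the state
  argument, so linearity lets them pass each other.\<close>

lemma signed_comp_linear_op:
  assumes "linear_op T"
  shows "signed_comp n (\<lambda>as. T (F as) A) bs = T (\<lambda>B. signed_comp n (\<lambda>as. F as B) bs) A"
proof (induction n arbitrary: F bs rule: less_induct)
  case (less n)
  show ?case
  proof (cases n)
    case (Suc m)
    have "signed_comp (m - k) (slice (Suc k) (\<lambda>as. T (F as) A)) bs =
        T (\<lambda>B. signed_comp (m - k) (slice (Suc k) (\<lambda>as. F as B)) bs) A" for k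
      unfolding slice_def[abs_def] by (rule less.IH) (use Suc in auto)
    then show ?thesis by (simp add: Suc linear_opD[OF assms])
  qed simp
qed

lemma omega_list_linear_op:
  assumes "linear_op T"
  shows "omega_list (\<lambda>as. T (F as) A) ns = T (\<lambda>B. omega_list (\<lambda>as. F as B) ns) A"
proof (induction ns arbitrary: F)
  case (Cons n ns)
  have "signed_comp n (\<lambda>as. T (F as) A) = (\<lambda>as. T (\<lambda>B. signed_comp n (\<lambda>as. F as B) as) A)"
    by (rule ext) (rule signed_comp_linear_op[OF assms])
  then show ?case by (simp add: Cons.IH)
qed simp

locale skew_states =
  fixes Nu Lam :: "(nat \<times> nat) set" and L :: nat
  assumes Nu_ideal: "order_ideal Nu" and Lam_ideal: "order_ideal Lam"
    and Nu_Lam: "Nu \<subseteq> Lam" and Lam_bound: "Lam \<subseteq> {..<L} \<times> {..<L}"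
begin

section \<open>Shapes between \<open>Nu\<close> and \<open>Lam\<close> and their corners\<close>

definition states :: "(nat \<times> nat) set set" where
  "states = {A. Nu \<subseteq> A \<and> A \<subseteq> Lam \<and> order_ideal A}"

text \<open>A box \<open>(i, j)\<close> lies on diagonal \<open>d = j - i + L\<close>; the shift by \<open>L\<close> keeps diagonals natural.\<close>

definition corners :: "nat \<Rightarrow> (nat \<times> nat) set \<Rightarrow> (nat \<times> nat) set" where
  "corners d A = {(i, j) \<in> A - Nu. (i, Suc j) \<notin> A \<and> (Suc i, j) \<notin> A \<and> j + L = d + i}"

text \<open>The transpose of adding a box: the value at \<open>A\<close> collects \<open>g\<close> over the states that are turned into \<open>A\<close>,
  so the last letter inserted is the outermost operator.\<close>

definition box_op :: "nat \<Rightarrow> ((nat \<times> nat) set \<Rightarrow> int) \<Rightarrow> (nat \<times> nat) set \<Rightarrow> int" where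
  "box_op d g A = (if A \<in> states then \<Sum>b\<in>corners d A. g A + g (A - {b}) else 0)"

text \<open>\<open>strip_op d k\<close> is the coefficient of \<open>x\<^sup>k\<close> in \<open>(1 + x u\<^bsub>d-1\<^esub>) \<cdots> (1 + x u\<^sub>0)\<close>; the integer index avoids a case
  distinction for \<open>k - 1\<close> at \<open>k = 0\<close>.\<close>

fun strip_op :: "nat \<Rightarrow> int \<Rightarrow> ((nat \<times> nat) set \<Rightarrow> int) \<Rightarrow> (nat \<times> nat) set \<Rightarrow> int" where
  "strip_op 0 k g A = (if k = 0 then g A else 0)"
| "strip_op (Suc d) k g A = strip_op d k g A + box_op d (strip_op d (k - 1) g) A"

lemma states_ideal: "A \<in> states \<Longrightarrow> order_ideal A"
  by (simp add: states_def)

text \<open>Boxes on equal or neighbouring diagonals are comparable, so a box of \<open>A\<close>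
  not weakly north-west of the corner would force the right or lower neighbour of the corner into
  \<open>A\<close>.\<close>

lemma corner_less:
  assumes "order_ideal A" "(i, j) \<in> corners d A" "(i', j') \<in> A" "j' + L = d' + i'"
    "d' \<le> Suc d" "d \<le> Suc d'"
  shows "i' \<le> i \<and> j' \<le> j"
proof -
  have 1: "\<not> (Suc i \<le> i' \<and> j \<le> j')" "\<not> (i \<le> i' \<and> Suc j \<le> j')"
    using assms(2) order_idealD[OF assms(1,3)] by (auto simp: corners_def)
  have "j + L = d + i" using assms(2) by (auto simp: corners_def)
  then show ?thesis using 1 assms(4-6) by linarith
qed

lemma cornersD:
  "(i, j) \<in> corners d A \<Longrightarrow> (i, j) \<in> A \<and> (i, Suc j) \<notin> A \<and> (Suc i, j) \<notin> A \<and> j + L = d + i"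
  by (simp add: corners_def)

text \<open>Leaves at most one term in the sum defining \<open>box_op\<close>.\<close>

lemma corners_unique:
  assumes "order_ideal A" "b \<in> corners d A"
  shows "corners d A = {b}"
proof -
  obtain i j where b: "b = (i, j)" by force
  have "(p, q) = b" if "(p, q) \<in> corners d A" for p q
  proof -
    have "i \<le> p \<and> j \<le> q"
      using corner_less[OF assms(1) that, of i j d] cornersD[of i j d A] assms(2) b by simp
    moreover have "p \<le> i \<and> q \<le> j"
      using corner_less[OF assms(1), of i j d p q d] cornersD[OF that] assms(2) b by simp
    ultimately show ?thesis by (simp add: b)
  qed
  then show ?thesis using assms by fast
qed

lemma remove_corner_states:
  assumes "A \<in> states" "b \<in> corners d A"
  shows "A - {b} \<in> states"
proof -
  obtain i j where b: "b = (i, j)" by force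
  have A: "order_ideal A" using assms by (simp add: states_def)
  have "(i', j') \<in> A - {b}" if "(p, q) \<in> A - {b}" "i' \<le> p" "j' \<le> q" for p q i' j'
  proof -
    have "(i', j') \<noteq> b"
    proof
      assume "(i', j') = b"
      then have *: "i \<le> p" "j \<le> q" "p \<noteq> i \<or> q \<noteq> j" using that b by auto
      then have "Suc i \<le> p \<or> Suc j \<le> q" by linarith
      then have "(Suc i, j) \<in> A \<or> (i, Suc j) \<in> A"
        using order_idealD[OF A, of p q] that * by blast
      then show False using assms(2) b by (auto simp: corners_def)
    qed
    then show ?thesis using order_idealD[OF A, of p q i' j'] that by auto
  qed
  then have "order_ideal (A - {b})" unfolding order_ideal_def by blast
  moreover have "b \<notin> Nu" using assms(2) by (auto simp: corners_def)
  ultimately show ?thesis using assms(1) by (auto simp: states_def)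
qed

text \<open>A box further up the diagonal keeps its lower neighbour, so no new corner appears; this
  makes \<open>box_op d\<close> idempotent.\<close>

lemma corners_remove_same:
  assumes "A \<in> states" "b \<in> corners d A"
  shows "corners d (A - {b}) = {}"
proof -
  obtain i j where b: "b = (i, j)" by force
  note A = states_ideal[OF assms(1)]
  have False if "(p, q) \<in> corners d (A - {b})" for p q
  proof -
    have *: "(p, q) \<in> A" "(p, q) \<noteq> b" "q + L = d + p" "(Suc p, q) \<notin> A - {b}"
      using that by (auto simp: corners_def)
    have bA: "(i, j) \<in> A" "j + L = d + i" using cornersD[of i j d A] assms(2) b by simp_all
    have "p \<le> i \<and> q \<le> j" using corner_less[OF A, of i j d p q d] assms(2) b * by simp
    then have "p < i" "q < j" using * bA by (auto simp: b)
    then show False using order_idealD[OF A bA(1), of "Suc p" q] * by (auto simp: b)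
  qed
  then show ?thesis by auto
qed

lemma corners_remove_far:
  assumes "b \<in> corners d A" "Suc d < d' \<or> Suc d' < d"
  shows "corners d' (A - {b}) = corners d' A"
  using assms by (auto simp: corners_def)

text \<open>By \<open>corner_less\<close>, two corners on neighbouring diagonals would each lie
  weakly north-west of the other.\<close>

lemma corners_adjacent_empty:
  assumes "A \<in> states" "b \<in> corners d A" "d' = Suc d \<or> d = Suc d'"
  shows "corners d' A = {}"
proof -
  obtain i j where b: "b = (i, j)" by force
  note A = states_ideal[OF assms(1)]
  have False if "(p, q) \<in> corners d' A" for p q
  proof -
    note D = cornersD[OF that] cornersD[OF assms(2)[unfolded b]]
    have "p \<le> i \<and> q \<le> j" using corner_less[OF A assms(2)[unfolded b], of p q d'] D assms(3) by auto
    moreover have "i \<le> p \<and> j \<le> q" using corner_less[OF A that, of i j d] D assms(3) by auto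
    ultimately show False using D assms(3) by auto
  qed
  then show ?thesis by auto
qed

text \<open>The next box up diagonal \<open>d\<close> is shielded by both its right and its lower
  neighbour, and \<open>c\<close> can be only one of them.\<close>

lemma corners_remove_two:
  assumes "A \<in> states" "b \<in> corners d A" "c \<in> corners d' (A - {b})" "d' = Suc d \<or> d = Suc d'"
  shows "corners d (A - {b} - {c}) = {}"
proof -
  obtain i j where b: "b = (i, j)" by force
  note A = states_ideal[OF assms(1)]
  have bA: "(i, j) \<in> A" using assms(2) by (simp add: b corners_def)
  have ij: "j + L = d + i" using cornersD assms(2) b by simp
  have False if pq: "(p, q) \<in> corners d (A - {b} - {c})" for p q
  proof -
    have D: "(p, q) \<in> A" "(p, q) \<noteq> b" "q + L = d + p"
      using pq by (auto simp: corners_def)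
    have "p \<le> i \<and> q \<le> j" using corner_less[OF A assms(2)[unfolded b], of p q d] D by simp
    then have "p < i" "q < j" using D ij by (auto simp: b)
    then have "(Suc p, q) \<in> A - {b}" "(p, Suc q) \<in> A - {b}" using order_idealD[OF A bA] by (auto simp: b)
    then have "c = (Suc p, q)" "c = (p, Suc q)" using pq by (auto simp: corners_def)
    then show False by simp
  qed
  then show ?thesis by auto
qed

section \<open>Relations between the box operators\<close>

lemma box_op_linear: "linear_op (box_op d)"
  unfolding linear_op_def
proof (intro allI ext)
  fix I :: "nat set" and c F A
  show "box_op d (\<lambda>B. \<Sum>i\<in>I. c i * F i B) A = (\<Sum>i\<in>I. c i * box_op d (F i) A)"
    by (simp add: box_op_def sum.distrib[symmetric] sum_distrib_left distrib_left)
      (rule impI, rule sum.swap)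
qed

lemma box_op_idem: "box_op d (box_op d g) = box_op d g"
proof
  fix A
  show "box_op d (box_op d g) A = box_op d g A"
  proof (cases "A \<in> states \<and> corners d A \<noteq> {}")
    case True
    then obtain b where b: "b \<in> corners d A" by blast
    have "box_op d g (A - {b}) = 0" using True b corners_remove_same by (simp add: box_op_def)
    then show ?thesis
      using True corners_unique[OF states_ideal b] by (subst box_op_def) simp
  qed (auto simp: box_op_def)
qed

lemma box_op_far:
  assumes "Suc d < d' \<or> Suc d' < d"
  shows "box_op d (box_op d' g) = box_op d' (box_op d g)"
proof
  fix A
  \<comment> \<open>The two removals do not interact, so this expansion is symmetric in
    \<open>d\<close> and \<open>d'\<close>.\<close>
  have *: "box_op d (box_op d' g) A = (\<Sum>b\<in>corners d A. \<Sum>c\<in>corners d' A.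
      g A + g (A - {b}) + g (A - {c}) + g (A - {b, c}))"
    if "Suc d < d' \<or> Suc d' < d" "A \<in> states" for d d'
  proof -
    have "box_op d' g (A - {b}) = (\<Sum>c\<in>corners d' A. g (A - {b}) + g (A - {b, c}))" if "b \<in> corners d A" for b
      using that \<open>A \<in> states\<close> \<open>Suc d < d' \<or> Suc d' < d\<close> unfolding box_op_def
      by (simp add: remove_corner_states corners_remove_far insert_commute flip: Diff_insert)
    then show ?thesis using \<open>A \<in> states\<close>
      by (subst box_op_def) (auto simp: box_op_def sum.distrib[symmetric] algebra_simps intro!: sum.cong)
  qed
  show "box_op d (box_op d' g) A = box_op d' (box_op d g) A"
  proof (cases "A \<in> states")
    case True
    then show ?thesis
      using *[of d d'] *[of d' d] assms by (simp add: insert_commute ac_simps) (subst sum.swap, simp add: insert_commute add.left_commute)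
  qed (simp add: box_op_def)
qed

text \<open>A corner \<open>b\<close> on \<open>d\<close> excludes one on \<open>d'\<close>. Once
  \<open>b\<close> is removed, \<open>d\<close> has no corner, neither before nor after a removal on
  \<open>d'\<close>, so the innermost factor vanishes everywhere it is evaluated.\<close>

lemma box_op_braid:
  assumes "d' = Suc d \<or> d = Suc d'"
  shows "box_op d (box_op d' (box_op d g)) A = 0"
proof (cases "A \<in> states \<and> corners d A \<noteq> {}")
  case True
  then obtain b where b: "b \<in> corners d A" by blast
  have A: "A \<in> states" using True by simp
  have "box_op d' (box_op d g) A = 0"
    using corners_adjacent_empty[OF A b assms] by (simp add: box_op_def)
  moreover have "box_op d g (A - {b}) + box_op d g (A - {b} - {c}) = 0" if "c \<in> corners d' (A - {b})" for c
    unfolding box_op_def using corners_remove_same[OF A b] corners_remove_two[OF A b that assms] by simp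
  then have "box_op d' (box_op d g) (A - {b}) = 0"
    by (subst box_op_def) simp
  ultimately show ?thesis
    using A corners_unique[OF states_ideal[OF A] b] by (subst box_op_def) simp
qed (auto simp: box_op_def)

section \<open>Commutation of the strip operators\<close>

lemma strip_op_linear: "linear_op (strip_op d k)"
proof (induction d arbitrary: k)
  case 0
  then show ?case by (simp add: linear_op_def fun_eq_iff)
next
  case (Suc d)
  have "strip_op (Suc d) k = (\<lambda>g A. \<Sum>i\<in>{0, 1::nat}. 1 * (if i = 0 then strip_op d k else (\<lambda>g. box_op d (strip_op d (k - 1) g))) g A)"
    by (simp add: fun_eq_iff)
  moreover have "linear_op \<dots>"
    by (rule linear_op_comb) (use Suc box_op_linear in \<open>auto intro: linear_op_compose\<close>)
  ultimately show ?case by simp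
qed

lemmas box_op_add = linear_op_add[OF box_op_linear] and box_op_zero = linear_op_zero[OF box_op_linear]
  and strip_op_add = linear_op_add[OF strip_op_linear]

lemma strip_op_neg: "k < 0 \<Longrightarrow> strip_op d k g A = 0"
proof (induction d arbitrary: k A)
  case (Suc d)
  then have "strip_op d (k - 1) g = (\<lambda>A. 0)" by (simp add: fun_eq_iff)
  then show ?case using Suc by (simp add: box_op_zero)
qed simp

lemma strip_op_0: "strip_op d 0 g A = g A"
proof (induction d)
  case (Suc d)
  have "strip_op d (- 1) g = (\<lambda>A. 0)" by (simp add: fun_eq_iff strip_op_neg)
  then show ?case using Suc by (simp add: box_op_zero)
qed simp

text \<open>All factors of \<open>strip_op d\<close> sit on diagonals below \<open>d\<close>, at
  distance at least two from \<open>d'\<close>.\<close>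

lemma box_op_strip_op_far: "d < d' \<Longrightarrow> strip_op d k (box_op d' g) A = box_op d' (strip_op d k g) A"
proof (induction d arbitrary: k A)
  case 0
  have "strip_op 0 k g = (if k = 0 then g else (\<lambda>B. 0))" by (auto simp: fun_eq_iff)
  then show ?case by (auto simp: box_op_zero)
next
  case (Suc d)
  have "strip_op d k (box_op d' g) = box_op d' (strip_op d k g)" for k using Suc by (simp add: fun_eq_iff)
  moreover have "strip_op (Suc d) k g = (\<lambda>A. strip_op d k g A + box_op d (strip_op d (k - 1) g) A)" by (simp add: fun_eq_iff)
  moreover have "box_op d (box_op d' (strip_op d (k - 1) g)) = box_op d' (box_op d (strip_op d (k - 1) g))" using Suc.prems by (intro box_op_far) simp
  ultimately show ?case using Suc.prems by (simp add: box_op_add)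
qed

lemma strip_op_Suc: "strip_op (Suc d) k g = (\<lambda>A. strip_op d k g A + box_op d (strip_op d (k - 1) g) A)"
  by (simp add: fun_eq_iff)

text \<open>The recursion step is symmetric in \<open>j\<close> and \<open>k\<close> as soon as the \<open>strip_op (Suc d)\<close> commute.\<close>

lemma strip_op_Suc_Suc_comp:
  fixes d defines "Z \<equiv> strip_op (Suc d)" and "a \<equiv> box_op d" and "b \<equiv> box_op (Suc d)"
  shows "strip_op (Suc (Suc d)) j (strip_op (Suc (Suc d)) k g) A =
    Z j (Z k g) A + b (Z (j - 1) (Z k g)) A + b (Z j (Z (k - 1) g)) A + b (Z (j - 1) (Z (k - 1) g)) A
    + a (b (Z (j - 1) (Z (k - 1) g))) A - b (a (Z (j - 1) (Z (k - 1) g))) A"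
proof -
  have far: "strip_op d j (b h) = b (strip_op d j h)" for j h unfolding b_def by (simp add: fun_eq_iff box_op_strip_op_far)
  have rel: "b (b h) = b h" "a (a h) = a h" "a (b (a h)) = (\<lambda>A. 0)" "b (a (b h)) = (\<lambda>A. 0)" for h
    unfolding a_def b_def by (simp_all add: box_op_idem box_op_braid fun_eq_iff)
  have add: "a (\<lambda>B. f B + h B) = (\<lambda>A. a f A + a h A)" "b (\<lambda>B. f B + h B) = (\<lambda>A. b f A + b h A)"
    "strip_op d j (\<lambda>B. f B + h B) = (\<lambda>A. strip_op d j f A + strip_op d j h A)" for f h j
    unfolding a_def b_def by (simp_all add: box_op_add strip_op_add fun_eq_iff)
  have Z: "Z j h = (\<lambda>A. strip_op d j h A + a (strip_op d (j - 1) h) A)" for j h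
    unfolding Z_def a_def by (rule strip_op_Suc)
  have E: "strip_op (Suc (Suc d)) j h = (\<lambda>A. Z j h A + b (Z (j - 1) h) A)" for j h
    unfolding Z_def b_def by (rule strip_op_Suc)
  have zero: "b (\<lambda>A. 0) = (\<lambda>A. 0)" unfolding b_def by (simp add: fun_eq_iff box_op_zero)
  \<comment> \<open>With \<open>U(x) = (1 + x b) Z(x)\<close> this reads \<open>U(x) U(y) = (1 + (x
    + y + x y) b + x y (a b - b a)) Z(x) Z(y)\<close>: \<open>b\<close> passes the part of
    \<open>Z(x)\<close> below \<open>a\<close>, and \<open>rel\<close> shortens the resulting words
    in \<open>a\<close> and \<open>b\<close>.\<close>
  show ?thesis
    unfolding E Z add far rel zero by simp
qed

lemma strip_op_commute: "strip_op d j (strip_op d k g) A = strip_op d k (strip_op d j g) A"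
proof (induction d arbitrary: j k g A rule: less_induct)
  case (less d)
  consider "d = 0" | "d = 1" | d' where "d = Suc (Suc d')"
    by (metis One_nat_def not0_implies_Suc)
  then show ?case
  proof cases
    case 1
    then show ?thesis by simp
  next
    case 2
    have "strip_op 0 k h = (if k = 0 then h else (\<lambda>B. 0))" for k h by (auto simp: fun_eq_iff)
    then show ?thesis by (auto simp: 2 strip_op_Suc box_op_add box_op_zero box_op_idem)
  next
    case 3
    have "strip_op (Suc d') j (strip_op (Suc d') k h) = strip_op (Suc d') k (strip_op (Suc d') j h)" for j k h
      using less 3 by (simp add: fun_eq_iff del: strip_op.simps)
    then show ?thesis unfolding 3 strip_op_Suc_Suc_comp by (simp del: strip_op.simps)
  qed
qed

section \<open>Operator words and their image under the involution\<close>

definition start :: "(nat \<times> nat) set \<Rightarrow> int" where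
  "start A = (if A = Nu then 1 else 0)"

text \<open>\<open>weak_op n\<close> is the coefficient of \<open>x\<^sup>n\<close> in \<open>U(-x)\<^bsup>-1\<^esup>\<close>.\<close>

fun weak_op :: "nat \<Rightarrow> ((nat \<times> nat) set \<Rightarrow> int) \<Rightarrow> (nat \<times> nat) set \<Rightarrow> int" where
  "weak_op 0 g = g"
| "weak_op (Suc n) g = (\<lambda>A. \<Sum>k\<le>n. (-1) ^ k * strip_op (2 * L) (int (Suc k)) (weak_op (n - k) g) A)"

text \<open>The head of the list is the outermost operator, hence the letter inserted last: content
  \<open>as\<close> corresponds to \<open>strip_word (rev as)\<close>. The bound
  \<open>2 * L\<close> exceeds \<open>j - i + L\<close> for all \<open>i, j < L\<close>.\<close>

fun strip_word :: "nat list \<Rightarrow> (nat \<times> nat) set \<Rightarrow> int" where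
  "strip_word [] = start"
| "strip_word (k # ks) = strip_op (2 * L) (int k) (strip_word ks)"

fun weak_word :: "nat list \<Rightarrow> (nat \<times> nat) set \<Rightarrow> int" where
  "weak_word [] = start"
| "weak_word (k # ks) = weak_op k (weak_word ks)"

lemma weak_op_linear: "linear_op (weak_op n)"
proof (induction n rule: less_induct)
  case (less n)
  show ?case
  proof (cases n)
    case 0
    then show ?thesis by (simp add: linear_op_def)
  next
    case (Suc m)
    have "weak_op (Suc m) = (\<lambda>g A. \<Sum>k\<le>m. (-1) ^ k * strip_op (2 * L) (int (Suc k)) (weak_op (m - k) g) A)"
      by (simp add: fun_eq_iff)
    moreover have "linear_op (\<lambda>g A. \<Sum>k\<le>m. (-1) ^ k * strip_op (2 * L) (int (Suc k)) (weak_op (m - k) g) A)"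
      by (rule linear_op_comb, rule linear_op_compose[OF strip_op_linear]) (use less Suc in auto)
    ultimately show ?thesis by (simp only: Suc)
  qed
qed

lemma sym_list_strip_word: "sym_list (\<lambda>as. strip_word as A)"
proof -
  have *: "strip_word (xs @ a # ys) = strip_word (a # xs @ ys)" for xs a ys
  proof (induction xs)
    case (Cons x xs)
    then show ?case by simp (intro ext strip_op_commute)
  qed simp
  have "strip_word as = strip_word bs" if "mset as = mset bs" for as bs
    using that
  proof (induction as arbitrary: bs)
    case (Cons a as)
    from Cons.prems have "a \<in> set bs" by (metis list.set_intros(1) set_mset_mset)
    then obtain xs ys where bs: "bs = xs @ a # ys" by (meson split_list)
    with Cons.prems have "mset as = mset (xs @ ys)" by simp
    from Cons.IH[OF this] show ?case by (simp add: bs *)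
  qed simp
  moreover have "strip_word (0 # as) = strip_word as" for as
    by (simp add: fun_eq_iff strip_op_0)
  ultimately show ?thesis unfolding sym_list_def by metis
qed

text \<open>Fixing the first entry of a word applies one strip operator, so the recursion of
  \<open>signed_comp\<close> becomes that of \<open>weak_op\<close>.\<close>

lemma signed_comp_strip_word: "signed_comp n (\<lambda>as. strip_word as A) bs = weak_op n (strip_word bs) A"
proof (induction n arbitrary: A bs rule: less_induct)
  case (less n)
  show ?case
  proof (cases n)
    case (Suc m)
    have "signed_comp (m - k) (slice (Suc k) (\<lambda>as. strip_word as A)) bs =
        strip_op (2 * L) (int (Suc k)) (weak_op (m - k) (strip_word bs)) A" for k
      unfolding slice_def[abs_def] strip_word.simps signed_comp_linear_op[OF strip_op_linear]
      using Suc by (simp add: less.IH del: strip_op.simps)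
    then show ?thesis by (simp add: Suc)
  qed simp
qed

lemma omega_list_strip_word: "omega_list (\<lambda>as. strip_word as A) ns = weak_word ns A"
proof (induction ns arbitrary: A)
  case (Cons n ns)
  have "omega_list (\<lambda>as. strip_word as A) (n # ns) = omega_list (\<lambda>as. weak_op n (strip_word as) A) ns"
    by (simp add: signed_comp_strip_word[abs_def])
  then show ?case by (simp add: omega_list_linear_op[OF weak_op_linear] Cons.IH)
qed simp

end

section \<open>Counting tableaux by removing the largest letter\<close>
text \<open>Allows the row and column conditions to be rewritten under the conditions on the
  support.\<close>

lemma conj_cong_four:
  assumes "A \<and> B \<longleftrightarrow> A' \<and> B'" "A' \<Longrightarrow> B' \<Longrightarrow> C = C'" "A' \<Longrightarrow> B' \<Longrightarrow> D = D'"
  shows "A \<and> B \<and> C \<and> D \<longleftrightarrow> A' \<and> B' \<and> C' \<and> D'"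
  using assms by blast

text \<open>Entrywise inequalities replace \<open>Max\<close> and \<open>Min\<close> and hold
  vacuously at boxes outside the shape, so the effect of adding or deleting one entry can be checked
  locally.\<close>

lemma set_valued_tableau_iff:
  "set_valued_tableau S T \<longleftrightarrow> (\<forall>b. T b \<noteq> {} \<longleftrightarrow> b \<in> S) \<and> (\<forall>b. finite (T b) \<and> 0 \<notin> T b) \<and>
    (\<forall>i j x y. x \<in> T (i, j) \<longrightarrow> y \<in> T (i, Suc j) \<longrightarrow> x \<le> y) \<and>
    (\<forall>i j x y. x \<in> T (i, j) \<longrightarrow> y \<in> T (Suc i, j) \<longrightarrow> x < y)"
  (is "_ \<longleftrightarrow> ?shape \<and> ?fin \<and> ?row \<and> ?col")
proof -
  have "(\<forall>b. b \<notin> S \<longrightarrow> T b = {}) \<and> (\<forall>b\<in>S. finite (T b) \<and> T b \<noteq> {} \<and> (\<forall>a\<in>T b. a > 0)) \<longleftrightarrow> ?shape \<and> ?fin"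
    by (metis finite.emptyI gr0I less_irrefl empty_iff)
  moreover have
    "(\<forall>i j. (i, j) \<in> S \<and> (i, Suc j) \<in> S \<longrightarrow> Max (T (i, j)) \<le> Min (T (i, Suc j))) \<longleftrightarrow> ?row"
    "(\<forall>i j. (i, j) \<in> S \<and> (Suc i, j) \<in> S \<longrightarrow> Max (T (i, j)) < Min (T (Suc i, j))) \<longleftrightarrow> ?col"
    if ?shape ?fin
  proof -
    have mem: "b \<in> S" if "v \<in> T b" for v b using \<open>?shape\<close> that by blast
    have 1: "((i, j) \<in> S \<and> (i, Suc j) \<in> S \<longrightarrow> Max (T (i, j)) \<le> Min (T (i, Suc j))) \<longleftrightarrow>
        (\<forall>x y. x \<in> T (i, j) \<longrightarrow> y \<in> T (i, Suc j) \<longrightarrow> x \<le> y)" for i j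
      using that by (cases "(i, j) \<in> S \<and> (i, Suc j) \<in> S") (auto dest: mem)
    have 2: "((i, j) \<in> S \<and> (Suc i, j) \<in> S \<longrightarrow> Max (T (i, j)) < Min (T (Suc i, j))) \<longleftrightarrow>
        (\<forall>x y. x \<in> T (i, j) \<longrightarrow> y \<in> T (Suc i, j) \<longrightarrow> x < y)" for i j
      using that by (cases "(i, j) \<in> S \<and> (Suc i, j) \<in> S") (auto dest: mem)
    show "(\<forall>i j. (i, j) \<in> S \<and> (i, Suc j) \<in> S \<longrightarrow> Max (T (i, j)) \<le> Min (T (i, Suc j))) \<longleftrightarrow> ?row"
      using 1 by blast
    show "(\<forall>i j. (i, j) \<in> S \<and> (Suc i, j) \<in> S \<longrightarrow> Max (T (i, j)) < Min (T (Suc i, j))) \<longleftrightarrow> ?col"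
      using 2 by blast
  qed
  ultimately show ?thesis unfolding set_valued_tableau_def by (rule conj_cong_four)
qed

lemma weak_set_valued_tableau_iff:
  "weak_set_valued_tableau S T \<longleftrightarrow> (\<forall>b. T b \<noteq> {#} \<longleftrightarrow> b \<in> S) \<and> (\<forall>b. 0 \<notin># T b) \<and>
    (\<forall>i j x y. x \<in># T (i, j) \<longrightarrow> y \<in># T (i, Suc j) \<longrightarrow> x < y) \<and>
    (\<forall>i j x y. x \<in># T (i, j) \<longrightarrow> y \<in># T (Suc i, j) \<longrightarrow> x \<le> y)"
  (is "_ \<longleftrightarrow> ?shape \<and> ?fin \<and> ?row \<and> ?col")
proof -
  have "(\<forall>b. b \<notin> S \<longrightarrow> T b = {#}) \<and> (\<forall>b\<in>S. T b \<noteq> {#} \<and> (\<forall>a\<in>#T b. a > 0)) \<longleftrightarrow> ?shape \<and> ?fin"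
    by (metis gr0I less_irrefl empty_iff set_mset_empty)
  moreover have
    "(\<forall>i j. (i, j) \<in> S \<and> (i, Suc j) \<in> S \<longrightarrow> Max (set_mset (T (i, j))) < Min (set_mset (T (i, Suc j)))) \<longleftrightarrow> ?row"
    "(\<forall>i j. (i, j) \<in> S \<and> (Suc i, j) \<in> S \<longrightarrow> Max (set_mset (T (i, j))) \<le> Min (set_mset (T (Suc i, j)))) \<longleftrightarrow> ?col"
    if ?shape
  proof -
    have mem: "b \<in> S" if "v \<in># T b" for v b
      using \<open>?shape\<close> that by (metis empty_iff set_mset_empty)
    have 1: "((i, j) \<in> S \<and> (i, Suc j) \<in> S \<longrightarrow> Max (set_mset (T (i, j))) < Min (set_mset (T (i, Suc j)))) \<longleftrightarrow>
        (\<forall>x y. x \<in># T (i, j) \<longrightarrow> y \<in># T (i, Suc j) \<longrightarrow> x < y)" for i j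
      using that by (cases "(i, j) \<in> S \<and> (i, Suc j) \<in> S") (auto dest: mem)
    have 2: "((i, j) \<in> S \<and> (Suc i, j) \<in> S \<longrightarrow> Max (set_mset (T (i, j))) \<le> Min (set_mset (T (Suc i, j)))) \<longleftrightarrow>
        (\<forall>x y. x \<in># T (i, j) \<longrightarrow> y \<in># T (Suc i, j) \<longrightarrow> x \<le> y)" for i j
      using that by (cases "(i, j) \<in> S \<and> (Suc i, j) \<in> S") (auto dest: mem)
    show "(\<forall>i j. (i, j) \<in> S \<and> (i, Suc j) \<in> S \<longrightarrow> Max (set_mset (T (i, j))) < Min (set_mset (T (i, Suc j)))) \<longleftrightarrow> ?row"
      using 1 by blast
    show "(\<forall>i j. (i, j) \<in> S \<and> (Suc i, j) \<in> S \<longrightarrow> Max (set_mset (T (i, j))) \<le> Min (set_mset (T (Suc i, j)))) \<longleftrightarrow> ?col"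
      using 2 by blast
  qed
  ultimately show ?thesis unfolding weak_set_valued_tableau_def by (rule conj_cong_four)
qed

lemma set_valued_tableau_mem: "set_valued_tableau S T \<Longrightarrow> v \<in> T b \<Longrightarrow> b \<in> S"
  unfolding set_valued_tableau_def by blast

lemma weak_set_valued_tableau_mem: "weak_set_valued_tableau S T \<Longrightarrow> v \<in># T b \<Longrightarrow> b \<in> S"
  unfolding weak_set_valued_tableau_def by (metis count_empty not_in_iff)

context skew_states
begin

section \<open>Tableaux of given content, filtered by the diagonals of the largest letter\<close>

definition K_tabs :: "(nat \<times> nat) set \<Rightarrow> nat list \<Rightarrow> (nat \<times> nat \<Rightarrow> nat set) set" where
  "K_tabs A as = {T. set_valued_tableau (A - Nu) T \<and>
     (\<forall>i. nth_default 0 as i = card {b \<in> A - Nu. Suc i \<in> T b})}"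

text \<open>Tableaux whose largest letter is \<open>Suc (length ms)\<close>, occurs \<open>k\<close> times, and only on diagonals below \<open>d\<close>
  (on diagonals from \<open>d\<close> on in \<open>J_part\<close>), so that its last inserted occurrence can be removed.\<close>

definition K_part :: "(nat \<times> nat) set \<Rightarrow> nat list \<Rightarrow> nat \<Rightarrow> nat \<Rightarrow> (nat \<times> nat \<Rightarrow> nat set) set" where
  "K_part A ms k d = {T. set_valued_tableau (A - Nu) T \<and>
     (\<forall>i<length ms. card {b. Suc i \<in> T b} = ms ! i) \<and> card {b. Suc (length ms) \<in> T b} = k \<and>
     (\<forall>b. \<forall>v\<in>T b. v \<le> Suc (length ms)) \<and>
     (\<forall>i j. Suc (length ms) \<in> T (i, j) \<longrightarrow> j + L < d + i)}"

definition J_tabs :: "(nat \<times> nat) set \<Rightarrow> nat list \<Rightarrow> (nat \<times> nat \<Rightarrow> nat multiset) set" where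
  "J_tabs A as = {T. weak_set_valued_tableau (A - Nu) T \<and>
     (\<forall>i. nth_default 0 as i = (\<Sum>b\<in>A - Nu. count (T b) (Suc i)))}"

definition J_part :: "(nat \<times> nat) set \<Rightarrow> nat list \<Rightarrow> nat \<Rightarrow> nat \<Rightarrow> (nat \<times> nat \<Rightarrow> nat multiset) set" where
  "J_part A ms k d = {T. weak_set_valued_tableau (A - Nu) T \<and>
     (\<forall>i<length ms. (\<Sum>b\<in>Lam. count (T b) (Suc i)) = ms ! i) \<and>
     (\<Sum>b\<in>Lam. count (T b) (Suc (length ms))) = k \<and>
     (\<forall>b. \<forall>v\<in>#T b. v \<le> Suc (length ms)) \<and>
     (\<forall>i j. Suc (length ms) \<in># T (i, j) \<longrightarrow> d + i \<le> j + L)}"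

lemma finite_Lam: "finite Lam"
  using Lam_bound finite_subset by blast

lemma states_finite: "A \<in> states \<Longrightarrow> finite A"
  using finite_Lam finite_subset by (auto simp: states_def)

lemma states_bound: "A \<in> states \<Longrightarrow> (i, j) \<in> A \<Longrightarrow> i < L \<and> j < L"
  using Lam_bound by (auto simp: states_def)

lemma content_set: "set_valued_tableau (A - Nu) T \<Longrightarrow> {b \<in> A - Nu. v \<in> T b} = {b. v \<in> T b}"
  by (auto dest: set_valued_tableau_mem)

lemma finite_content_set: "A \<in> states \<Longrightarrow> set_valued_tableau (A - Nu) T \<Longrightarrow> finite {b. v \<in> T b}"
  using states_finite finite_subset[of "{b. v \<in> T b}" A] by (auto dest: set_valued_tableau_mem)

text \<open>Summation over the fixed set \<open>Lam\<close> makes contents comparable when the shape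
  loses a box.\<close>

lemma content_multiset:
  assumes "A \<in> states" "weak_set_valued_tableau (A - Nu) T"
  shows "(\<Sum>b\<in>A - Nu. count (T b) v) = (\<Sum>b\<in>Lam. count (T b) v)"
proof (rule sum.mono_neutral_left)
  show "\<forall>b\<in>Lam - (A - Nu). count (T b) v = 0"
    using assms(2) unfolding weak_set_valued_tableau_iff by (metis DiffD2 count_empty)
qed (use assms finite_Lam in \<open>auto simp: states_def\<close>)

lemma nth_default_snoc_iff:
  fixes ms :: "nat list"
  shows "(\<forall>i. nth_default 0 (ms @ [k]) i = c i) \<longleftrightarrow>
    (\<forall>i<length ms. c i = ms ! i) \<and> c (length ms) = k \<and> (\<forall>i>length ms. c i = 0)" (is "?l \<longleftrightarrow> ?r")
proof
  assume ?l
  then have "c i = nth_default 0 (ms @ [k]) i" for i by simp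
  then show ?r by (simp add: nth_default_append nth_default_def nth_append)
next
  assume r: ?r
  show ?l
  proof
    fix i
    show "nth_default 0 (ms @ [k]) i = c i"
      using r by (cases i "length ms" rule: linorder_cases) (simp_all add: nth_default_append nth_default_def nth_append)
  qed
qed

text \<open>Boxes of \<open>Lam\<close> have diagonals strictly between \<open>0\<close> and
  \<open>2 * L\<close>: at \<open>2 * L\<close> the filter admits every occurrence of the largest
  letter, at \<open>0\<close> none.\<close>

lemma K_part_last:
  assumes "A \<in> states"
  shows "K_part A ms k (2 * L) = K_tabs A (ms @ [k])"
proof (rule Set.set_eqI)
  fix T
  show "T \<in> K_part A ms k (2 * L) \<longleftrightarrow> T \<in> K_tabs A (ms @ [k])"
  proof (cases "set_valued_tableau (A - Nu) T")
    case True
    note T = True[unfolded set_valued_tableau_iff]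
    have diag: "j + L < 2 * L + i" if "v \<in> T (i, j)" for i j v
      using set_valued_tableau_mem[OF True that] states_bound[OF assms, of i j] by auto
    have zero: "card {b. v \<in> T b} = 0 \<longleftrightarrow> (\<forall>b. v \<notin> T b)" for v
      using finite_content_set[OF assms True, of v] by simp
    have "(\<forall>b. \<forall>v\<in>T b. v \<le> Suc (length ms)) \<longleftrightarrow> (\<forall>i>length ms. card {b. Suc i \<in> T b} = 0)"
      unfolding zero using T by (metis Suc_le_D Suc_le_mono not_less not_less_eq_eq)
    then have "T \<in> K_part A ms k (2 * L) \<longleftrightarrow> (\<forall>i<length ms. card {b. Suc i \<in> T b} = ms ! i) \<and>
        card {b. Suc (length ms) \<in> T b} = k \<and> (\<forall>i>length ms. card {b. Suc i \<in> T b} = 0)"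
      using True diag unfolding K_part_def by blast
    also have "\<dots> \<longleftrightarrow> T \<in> K_tabs A (ms @ [k])"
      unfolding K_tabs_def nth_default_snoc_iff using True
      by (simp only: content_set[OF True] mem_Collect_eq simp_thms)
    finally show ?thesis .
  qed (simp add: K_part_def K_tabs_def)
qed

lemma J_part_first:
  assumes "A \<in> states"
  shows "J_part A ms k 0 = J_tabs A (ms @ [k])"
proof (rule Set.set_eqI)
  fix T
  show "T \<in> J_part A ms k 0 \<longleftrightarrow> T \<in> J_tabs A (ms @ [k])"
  proof (cases "weak_set_valued_tableau (A - Nu) T")
    case True
    note T = True[unfolded weak_set_valued_tableau_iff]
    have sub: "b \<in> Lam \<and> (\<exists>i j. b = (i, j) \<and> i < L \<and> j < L)" if "v \<in># T b" for b v
      using weak_set_valued_tableau_mem[OF True that] states_bound[OF assms] assms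
      by (cases b) (auto simp: states_def)
    have diag: "0 + i \<le> j + L" if "v \<in># T (i, j)" for i j v
      using sub[OF that] by auto
    have zero: "(\<Sum>b\<in>Lam. count (T b) v) = 0 \<longleftrightarrow> (\<forall>b. v \<notin># T b)" for v
      using sub by (simp add: finite_Lam count_eq_zero_iff) blast
    have "(\<forall>b. \<forall>v\<in>#T b. v \<le> Suc (length ms)) \<longleftrightarrow> (\<forall>i>length ms. (\<Sum>b\<in>Lam. count (T b) (Suc i)) = 0)"
      unfolding zero using T by (metis Suc_le_D Suc_le_mono not_less not_less_eq_eq)
    then have "T \<in> J_part A ms k 0 \<longleftrightarrow> (\<forall>i<length ms. (\<Sum>b\<in>Lam. count (T b) (Suc i)) = ms ! i) \<and>
        (\<Sum>b\<in>Lam. count (T b) (Suc (length ms))) = k \<and> (\<forall>i>length ms. (\<Sum>b\<in>Lam. count (T b) (Suc i)) = 0)"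
      using True diag unfolding J_part_def by blast
    also have "\<dots> \<longleftrightarrow> T \<in> J_tabs A (ms @ [k])"
      unfolding J_tabs_def nth_default_snoc_iff using True by (simp add: content_multiset[OF assms])
    finally show ?thesis .
  qed (simp add: J_part_def J_tabs_def)
qed

lemma nth_default_snoc_0: "nth_default 0 (ms @ [0 :: nat]) = nth_default 0 ms"
  by (auto simp: nth_default_append nth_default_def fun_eq_iff)

lemma K_part_first:
  assumes "A \<in> states"
  shows "K_part A ms k 0 = (if k = 0 then K_tabs A ms else {})"
proof -
  have none: "T \<in> K_part A ms k 0 \<longleftrightarrow> T \<in> K_part A ms k (2 * L) \<and> (\<forall>b. Suc (length ms) \<notin> T b)" for T
  proof -
    have "\<not> j + L < i" if "T \<in> K_part A ms k 0" "v \<in> T (i, j)" for i j v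
      using set_valued_tableau_mem[of "A - Nu" T v "(i, j)"] that states_bound[OF assms, of i j]
      by (auto simp: K_part_def)
    then show ?thesis by (auto simp: K_part_def)
  qed
  have "k = 0 \<longleftrightarrow> (\<forall>b. Suc (length ms) \<notin> T b)" if "T \<in> K_part A ms k (2 * L)" for T
    using finite_content_set[OF assms, of T "Suc (length ms)"] that by (auto simp: K_part_def)
  then have "K_part A ms k 0 = (if k = 0 then K_part A ms k (2 * L) else {})"
    using none by auto
  then show ?thesis
    by (simp add: K_part_last assms K_tabs_def nth_default_snoc_0)
qed

lemma J_part_last:
  assumes "A \<in> states"
  shows "J_part A ms k (2 * L) = (if k = 0 then J_tabs A ms else {})"
proof -
  have sub: "b \<in> Lam \<and> (\<exists>i j. b = (i, j) \<and> i < L \<and> j < L)" if "T \<in> J_part A ms k d" "v \<in># T b" for b v d T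
    using weak_set_valued_tableau_mem[of "A - Nu" T v b] that states_bound[OF assms] assms
    by (cases b) (auto simp: states_def J_part_def)
  have none: "T \<in> J_part A ms k (2 * L) \<longleftrightarrow> T \<in> J_part A ms k 0 \<and> (\<forall>b. Suc (length ms) \<notin># T b)" for T
  proof -
    have "\<not> 2 * L + i \<le> j + L" if "T \<in> J_part A ms k (2 * L)" "v \<in># T (i, j)" for i j v
      using sub[OF that] by auto
    then show ?thesis by (fastforce simp: J_part_def)
  qed
  have "k = 0 \<longleftrightarrow> (\<forall>b. Suc (length ms) \<notin># T b)" if "T \<in> J_part A ms k 0" for T
  proof -
    have "k = (\<Sum>b\<in>Lam. count (T b) (Suc (length ms)))" using that by (simp add: J_part_def)
    then show ?thesis using sub[OF that] by (simp add: finite_Lam count_eq_zero_iff) blast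
  qed
  then have "J_part A ms k (2 * L) = (if k = 0 then J_part A ms k 0 else {})"
    using none by auto
  then show ?thesis
    by (simp add: J_part_first assms J_tabs_def nth_default_snoc_0)
qed

lemma corner_notin:
  assumes "b \<in> corners d A" "A \<in> states"
  shows "b \<in> A - Nu" "A - {b} \<in> states"
  using assms remove_corner_states by (auto simp: corners_def)

section \<open>Set-valued tableaux: one occurrence of the largest letter at a time\<close>

lemma K_part_insert:
  assumes A: "A \<in> states" and b: "b \<in> corners d A"
    and T: "T \<in> K_part A ms k d \<union> K_part (A - {b}) ms k d"
  defines "N \<equiv> Suc (length ms)"
  shows "N \<notin> T b" "T(b := insert N (T b)) \<in> K_part A ms (Suc k) (Suc d) - K_part A ms (Suc k) d"
proof -
  obtain i j where bij: "b = (i, j)" by force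
  note c = cornersD[OF b[unfolded bij]]
  \<comment> \<open>\<open>B\<close> is the shape before the insertion, in which the corner is
    either occupied already or still missing.\<close>
  obtain B where B: "B = A \<or> B = A - {b}" "B \<in> states" "T \<in> K_part B ms k d"
    using T A corner_notin[OF b A] by blast
  have tab: "set_valued_tableau (B - Nu) T" using B by (simp add: K_part_def)
  note t = tab[unfolded set_valued_tableau_iff]
  have le: "v \<le> N" if "v \<in> T x" for v x using B that unfolding K_part_def N_def by blast
  have diag: "q + L < d + p" if "N \<in> T (p, q)" for p q using B that by (auto simp: K_part_def N_def)
  show notin: "N \<notin> T b" using diag[of i j] c by (auto simp: bij)
  have "(i, Suc j) \<notin> B - Nu" "(Suc i, j) \<notin> B - Nu" using c B(1) by auto
  then have right: "T (i, Suc j) = {}" and below: "T (Suc i, j) = {}" using t by blast+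
  have left: "x \<le> N" if "x \<in> T (i, q)" for x q by (rule le[OF that])
  \<comment> \<open>The box above \<open>b\<close> is on diagonal \<open>d + 1\<close>, where
    \<open>N\<close> does not occur yet; if \<open>b\<close> has entries, they exceed those above
    and are at most \<open>N\<close>.\<close>
  have above: "x < N" if x: "x \<in> T (p, j)" and p: "i = Suc p" for x p
  proof -
    have "x \<noteq> N" if "T b = {}" using diag[of p j] x p c by auto
    moreover have "x < N" if "y \<in> T b" for y
      using t x p that le[OF that] bij by (metis less_le_trans)
    ultimately show ?thesis using le[OF x] by fastforce
  qed
  let ?T = "T(b := insert N (T b))"
  have "set_valued_tableau (A - Nu) ?T"
    unfolding set_valued_tableau_iff
  proof (intro conjI allI impI)
    fix x
    have "T x \<noteq> {} \<longleftrightarrow> x \<in> B - Nu" using t by blast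
    then show "?T x \<noteq> {} \<longleftrightarrow> x \<in> A - Nu"
      using B(1) corner_notin[OF b A] by (cases "x = b") auto
  next
    fix x
    have "finite (T x)" "0 \<notin> T x" using t by blast+
    then show "finite (?T x)" "0 \<notin> ?T x" by (auto simp: N_def)
  next
    fix p q x y assume "x \<in> ?T (p, q)" "y \<in> ?T (p, Suc q)"
    then show "x \<le> y" using t left right by (auto simp: bij split: if_splits)
  next
    fix p q x y assume "x \<in> ?T (p, q)" "y \<in> ?T (Suc p, q)"
    then show "x < y" using t above below by (auto simp: bij split: if_splits)
  qed
  moreover have "card {x. Suc l \<in> ?T x} = ms ! l" if "l < length ms" for l
  proof -
    have "{x. Suc l \<in> ?T x} = {x. Suc l \<in> T x}" using that by (auto simp: N_def)
    then show ?thesis using B that by (simp add: K_part_def)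
  qed
  moreover have "card {x. N \<in> ?T x} = Suc k"
  proof -
    have "{x. N \<in> ?T x} = insert b {x. N \<in> T x}" by auto
    then show ?thesis using B notin finite_content_set[OF B(2) tab, of N] by (simp add: K_part_def N_def)
  qed
  moreover have "v \<le> N" if "v \<in> ?T x" for v x using le[of v x] le[of v b] that by (auto split: if_splits)
  moreover have "q + L < Suc d + p" if "N \<in> ?T (p, q)" for p q
    using diag[of p q] that c by (auto simp: bij split: if_splits)
  moreover have "\<not> j + L < d + i" "N \<in> ?T (i, j)" using c by (simp_all add: bij)
  ultimately show "?T \<in> K_part A ms (Suc k) (Suc d) - K_part A ms (Suc k) d"
    unfolding K_part_def N_def by blast
qed

lemma K_part_remove:
  assumes A: "A \<in> states" and T: "T \<in> K_part A ms k (Suc d) - K_part A ms k d"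
  defines "N \<equiv> Suc (length ms)"
  obtains b where "b \<in> corners d A" "N \<in> T b" "k > 0"
    "T(b := T b - {N}) \<in> K_part A ms (k - 1) d \<union> K_part (A - {b}) ms (k - 1) d"
proof -
  have tab: "set_valued_tableau (A - Nu) T" using T by (simp add: K_part_def)
  note t = tab[unfolded set_valued_tableau_iff]
  have le: "v \<le> N" if "v \<in> T x" for v x using T that unfolding K_part_def N_def by blast
  have diag: "q + L < Suc d + p" if "N \<in> T (p, q)" for p q using T that by (auto simp: K_part_def N_def)
  obtain i j where ij: "N \<in> T (i, j)" "\<not> j + L < d + i"
    using T by (auto simp: K_part_def N_def)
  have corner: "(p, q) \<in> corners d A" if pq: "N \<in> T (p, q)" "\<not> q + L < d + p" for p q
  proof -
    have 1: "q + L = d + p" "(p, q) \<in> A - Nu" using diag[OF pq(1)] pq set_valued_tableau_mem[OF tab] by auto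
    have "(p, Suc q) \<notin> Nu" "(Suc p, q) \<notin> Nu"
      using 1 order_idealD[OF Nu_ideal, of p "Suc q" p q] order_idealD[OF Nu_ideal, of "Suc p" q p q] by auto
    moreover have "(p, Suc q) \<notin> A - Nu"
    proof
      assume "(p, Suc q) \<in> A - Nu"
      then obtain y where y: "y \<in> T (p, Suc q)" using t by blast
      then have "N \<le> y" using t pq(1) by blast
      then have "N \<in> T (p, Suc q)" using le[OF y] y by simp
      then show False using diag 1 by fastforce
    qed
    moreover have "(Suc p, q) \<notin> A - Nu"
    proof
      assume "(Suc p, q) \<in> A - Nu"
      then obtain y where y: "y \<in> T (Suc p, q)" using t by blast
      then have "N < y" using t pq(1) by blast
      then show False using le[OF y] by simp
    qed
    ultimately show ?thesis using 1 by (simp add: corners_def)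
  qed
  define b where "b = (i, j)"
  have b: "b \<in> corners d A" "N \<in> T b" using corner ij by (simp_all add: b_def)
  have fin: "finite {x. N \<in> T x}" using finite_content_set[OF A tab] .
  have k: "card {x. N \<in> T x} = k" using T by (simp add: K_part_def N_def)
  moreover have "{x. N \<in> T x} \<noteq> {}" using b by blast
  ultimately have "k > 0" using fin by (metis card_gt_0_iff)
  let ?T = "T(b := T b - {N})"
  define B where "B = (if T b = {N} then A - {b} else A)"
  have "set_valued_tableau (B - Nu) ?T"
    unfolding set_valued_tableau_iff
  proof (intro conjI allI impI)
    fix x
    have "T x \<noteq> {} \<longleftrightarrow> x \<in> A - Nu" using t by blast
    then show "?T x \<noteq> {} \<longleftrightarrow> x \<in> B - Nu"
      using b by (cases "x = b") (auto simp: B_def)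
  next
    fix x
    have "finite (T x)" "0 \<notin> T x" using t by blast+
    then show "finite (?T x)" "0 \<notin> ?T x" by auto
  next
    fix p q x y assume "x \<in> ?T (p, q)" "y \<in> ?T (p, Suc q)"
    then have "x \<in> T (p, q)" "y \<in> T (p, Suc q)" by (auto split: if_splits)
    then show "x \<le> y" using t by blast
  next
    fix p q x y assume "x \<in> ?T (p, q)" "y \<in> ?T (Suc p, q)"
    then have "x \<in> T (p, q)" "y \<in> T (Suc p, q)" by (auto split: if_splits)
    then show "x < y" using t by blast
  qed
  moreover have "card {x. Suc l \<in> ?T x} = ms ! l" if "l < length ms" for l
  proof -
    have "{x. Suc l \<in> ?T x} = {x. Suc l \<in> T x}" using that by (auto simp: N_def)
    then show ?thesis using T that by (simp add: K_part_def)
  qed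
  moreover have "card {x. N \<in> ?T x} = k - 1"
  proof -
    have "{x. N \<in> ?T x} = {x. N \<in> T x} - {b}" by auto
    then show ?thesis using b fin k by simp
  qed
  moreover have "v \<le> N" if "v \<in> ?T x" for v x using le[of v x] le[of v b] that by (auto split: if_splits)
  moreover have "q + L < d + p" if N: "N \<in> ?T (p, q)" for p q
  proof (rule ccontr)
    assume *: "\<not> q + L < d + p"
    from N have "N \<in> T (p, q)" "(p, q) \<noteq> b" by (auto split: if_splits)
    then show False using corner[OF _ *] corners_unique[OF states_ideal[OF A] b(1)] by auto
  qed
  ultimately have "?T \<in> K_part B ms (k - 1) d"
    unfolding K_part_def N_def by blast
  then show thesis using that b \<open>k > 0\<close> by (auto simp: B_def split: if_splits)
qed

lemma K_part_mono: "K_part A ms k d \<subseteq> K_part A ms k (Suc d)"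
  by (fastforce simp: K_part_def)

lemma K_part_0: "A \<in> states \<Longrightarrow> K_part A ms 0 (Suc d) = K_part A ms 0 d"
  using K_part_remove[of A _ ms 0 d] K_part_mono[of A ms 0 d] by blast

lemma K_part_no_corner: "A \<in> states \<Longrightarrow> corners d A = {} \<Longrightarrow> K_part A ms k (Suc d) = K_part A ms k d"
  using K_part_remove[of A _ ms k d] K_part_mono[of A ms k d] by blast

text \<open>The combinatorial form of the term \<open>x u_d\<close> in \<open>1 + x u_d\<close>: a
  tableau with \<open>N\<close> on diagonal \<open>d\<close> arises by a single insertion from one
  without, the corner being old or new.\<close>

lemma K_part_corner:
  assumes A: "A \<in> states" and b: "b \<in> corners d A"
  shows "bij_betw (\<lambda>T. T(b := insert (Suc (length ms)) (T b)))
    (K_part A ms k d \<union> K_part (A - {b}) ms k d) (K_part A ms (Suc k) (Suc d) - K_part A ms (Suc k) d)"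
proof (rule bij_betw_byWitness[where f' = "\<lambda>T. T(b := T b - {Suc (length ms)})"])
  have rem: "Suc (length ms) \<in> T b \<and> T(b := T b - {Suc (length ms)}) \<in> K_part A ms k d \<union> K_part (A - {b}) ms k d"
    if T: "T \<in> K_part A ms (Suc k) (Suc d) - K_part A ms (Suc k) d" for T
  proof -
    obtain b' where "b' \<in> corners d A" "Suc (length ms) \<in> T b'"
      "T(b' := T b' - {Suc (length ms)}) \<in> K_part A ms k d \<union> K_part (A - {b'}) ms k d"
      using K_part_remove[OF A T] by auto
    moreover from this have "b' = b" using corners_unique[OF states_ideal[OF A] b] by auto
    ultimately show ?thesis by blast
  qed
  then show "\<forall>T\<in>K_part A ms (Suc k) (Suc d) - K_part A ms (Suc k) d.
      (T(b := T b - {Suc (length ms)}))(b := insert (Suc (length ms)) ((T(b := T b - {Suc (length ms)})) b)) = T"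
    by (auto simp: insert_absorb)
  show "(\<lambda>T. T(b := T b - {Suc (length ms)})) ` (K_part A ms (Suc k) (Suc d) - K_part A ms (Suc k) d) \<subseteq>
      K_part A ms k d \<union> K_part (A - {b}) ms k d"
    using rem by blast
  show "\<forall>T\<in>K_part A ms k d \<union> K_part (A - {b}) ms k d.
      (T(b := insert (Suc (length ms)) (T b)))(b := (T(b := insert (Suc (length ms)) (T b))) b - {Suc (length ms)}) = T"
    using K_part_insert(1)[OF A b] by auto
  show "(\<lambda>T. T(b := insert (Suc (length ms)) (T b))) ` (K_part A ms k d \<union> K_part (A - {b}) ms k d) \<subseteq>
      K_part A ms (Suc k) (Suc d) - K_part A ms (Suc k) d"
    using K_part_insert(2)[OF A b] by blast
qed

lemma K_part_disjoint:
  assumes "A \<in> states" "b \<in> corners d A"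
  shows "K_part A ms k d \<inter> K_part (A - {b}) ms k d = {}"
proof -
  have "T b \<noteq> {}" if "T \<in> K_part A ms k d" for T
    using that corner_notin[OF assms(2,1)] unfolding K_part_def set_valued_tableau_iff by blast
  moreover have "T b = {}" if "T \<in> K_part (A - {b}) ms k d" for T
    using that unfolding K_part_def set_valued_tableau_iff by blast
  ultimately show ?thesis by blast
qed

lemma K_part_card:
  assumes "A \<in> states" and "\<And>B. B \<in> states \<Longrightarrow> finite (K_tabs B ms)"
  shows "finite (K_part A ms k d) \<and>
    int (card (K_part A ms k d)) = strip_op d (int k) (\<lambda>B. int (card (K_tabs B ms))) A"
  using assms(1)
proof (induction d arbitrary: A k)
  case 0
  then show ?case using assms(2) by (simp add: K_part_first)
next
  case (Suc d)
  let ?g = "\<lambda>B. int (card (K_tabs B ms))"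
  consider "k = 0" | "corners d A = {}" | k' b where "k = Suc k'" "b \<in> corners d A"
    using not0_implies_Suc by blast
  then show ?case
  proof cases
    case 1
    have "strip_op d (- 1) ?g = (\<lambda>B. 0)" by (simp add: fun_eq_iff strip_op_neg)
    then show ?thesis using Suc 1 by (simp add: K_part_0 box_op_zero)
  next
    case 2
    then show ?thesis using Suc by (simp add: K_part_no_corner box_op_def)
  next
    case 3
    let ?X = "K_part A ms k (Suc d) - K_part A ms k d"
    have "A - {b} \<in> states" using corner_notin[OF 3(2)] Suc.prems by blast
    then have fin: "finite (K_part A ms k' d)" "finite (K_part (A - {b}) ms k' d)"
      and card: "int (card (K_part A ms k' d)) = strip_op d (int k') ?g A"
        "int (card (K_part (A - {b}) ms k' d)) = strip_op d (int k') ?g (A - {b})"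
      using Suc by auto
    have bij: "bij_betw (\<lambda>T. T(b := insert (Suc (length ms)) (T b)))
        (K_part A ms k' d \<union> K_part (A - {b}) ms k' d) ?X"
      unfolding 3(1) by (rule K_part_corner[OF Suc.prems 3(2)])
    have "finite ?X" using bij_betw_finite[OF bij] fin by simp
    moreover have "card ?X = card (K_part A ms k' d) + card (K_part (A - {b}) ms k' d)"
      using bij_betw_same_card[OF bij] card_Un_disjoint[OF fin K_part_disjoint[OF Suc.prems 3(2)]] by simp
    moreover have "K_part A ms k (Suc d) = K_part A ms k d \<union> ?X" using K_part_mono by blast
    moreover have "finite (K_part A ms k d)" "int (card (K_part A ms k d)) = strip_op d (int k) ?g A"
      using Suc by auto
    moreover have "box_op d (strip_op d (int k - 1) ?g) A = strip_op d (int k') ?g A + strip_op d (int k') ?g (A - {b})"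
      unfolding box_op_def using Suc.prems corners_unique[OF states_ideal[OF Suc.prems] 3(2)] by (simp add: 3(1))
    moreover have "card (K_part A ms k d \<union> ?X) = card (K_part A ms k d) + card ?X"
      using calculation by (intro card_Un_disjoint) auto
    ultimately show ?thesis by (simp add: card)
  qed
qed

lemma tabs_empty:
  assumes "A \<in> states"
  shows "K_tabs A [] = (if A = Nu then {\<lambda>b. {}} else {})" "J_tabs A [] = (if A = Nu then {\<lambda>b. {#}} else {})"
proof -
  have Nu: "A = Nu \<longleftrightarrow> A - Nu = {}" using assms by (auto simp: states_def)
  have fin: "finite (A - Nu)" using states_finite[OF assms] by simp
  have "T \<in> K_tabs A [] \<longleftrightarrow> A = Nu \<and> T = (\<lambda>b. {})" for T
  proof
    assume T: "T \<in> K_tabs A []"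
    have "v \<notin> T b" for v b
    proof
      assume v: "v \<in> T b"
      have tab: "set_valued_tableau (A - Nu) T" using T by (simp add: K_tabs_def)
      have "b \<in> A - Nu" by (rule set_valued_tableau_mem[OF tab v])
      moreover have "v \<noteq> 0" using tab v unfolding set_valued_tableau_iff by metis
      moreover have "{b \<in> A - Nu. Suc i \<in> T b} = {}" for i
      proof -
        have "card {b \<in> A - Nu. Suc i \<in> T b} = 0" using T unfolding K_tabs_def by simp
        moreover have "finite {b \<in> A - Nu. Suc i \<in> T b}" by (rule finite_subset[OF _ fin]) auto
        ultimately show ?thesis by (simp only: card_0_eq)
      qed
      ultimately show False using v by (cases v) blast+
    qed
    then have "T = (\<lambda>b. {})" by (auto simp: fun_eq_iff)
    then show "A = Nu \<and> T = (\<lambda>b. {})" using T Nu by (auto simp: K_tabs_def set_valued_tableau_iff)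
  qed (auto simp: K_tabs_def set_valued_tableau_iff)
  then show "K_tabs A [] = (if A = Nu then {\<lambda>b. {}} else {})" by auto
  have "T \<in> J_tabs A [] \<longleftrightarrow> A = Nu \<and> T = (\<lambda>b. {#})" for T
  proof
    assume T: "T \<in> J_tabs A []"
    have "v \<notin># T b" for v b
    proof
      assume v: "v \<in># T b"
      have tab: "weak_set_valued_tableau (A - Nu) T" using T by (simp add: J_tabs_def)
      have "b \<in> A - Nu" by (rule weak_set_valued_tableau_mem[OF tab v])
      moreover have "v \<noteq> 0" using tab v unfolding weak_set_valued_tableau_iff by metis
      moreover have "\<forall>i. \<forall>b\<in>A - Nu. count (T b) (Suc i) = 0"
        using T fin by (simp add: J_tabs_def)
      ultimately show False using v by (cases v) (auto simp: count_eq_zero_iff)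
    qed
    then have "T = (\<lambda>b. {#})" by (auto simp: fun_eq_iff multiset_eq_iff not_in_iff)
    then show "A = Nu \<and> T = (\<lambda>b. {#})" using T Nu by (auto simp: J_tabs_def weak_set_valued_tableau_iff)
  qed (auto simp: J_tabs_def weak_set_valued_tableau_iff)
  then show "J_tabs A [] = (if A = Nu then {\<lambda>b. {#}} else {})" by auto
qed

text \<open>Counts and operator words are compared only on states, and evaluating a strip operator
  at a state never leaves them.\<close>

lemma strip_op_cong:
  assumes "\<And>B. B \<in> states \<Longrightarrow> g B = g' B" "A \<in> states"
  shows "strip_op d k g A = strip_op d k g' A"
  using assms(2)
proof (induction d arbitrary: k A)
  case (Suc d)
  have "box_op d (strip_op d (k - 1) g) A = box_op d (strip_op d (k - 1) g') A"
    unfolding box_op_def using Suc corner_notin by (auto intro!: sum.cong)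
  then show ?case using Suc by simp
qed (simp add: assms(1))

lemma K_tabs_card:
  "A \<in> states \<Longrightarrow> finite (K_tabs A as) \<and> int (card (K_tabs A as)) = strip_word (rev as) A"
proof (induction as arbitrary: A rule: rev_induct)
  case Nil
  then show ?case by (simp add: tabs_empty start_def)
next
  case (snoc k as)
  have "finite (K_part A as k (2 * L)) \<and>
      int (card (K_part A as k (2 * L))) = strip_op (2 * L) (int k) (\<lambda>B. int (card (K_tabs B as))) A"
    using snoc by (intro K_part_card) auto
  then show ?case
    using snoc strip_op_cong[of "\<lambda>B. int (card (K_tabs B as))" "strip_word (rev as)" A] by (simp add: K_part_last)
qed

section \<open>Weak tableaux: one occurrence of the largest letter at a time\<close>

lemma J_part_add:
  assumes A: "A \<in> states" and b: "b \<in> corners d A"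
    and T: "T \<in> J_part A ms k d \<union> J_part (A - {b}) ms k d"
  defines "N \<equiv> Suc (length ms)"
  shows "T(b := add_mset N (T b)) \<in> J_part A ms (Suc k) d - J_part A ms (Suc k) (Suc d)"
proof -
  obtain i j where bij: "b = (i, j)" by force
  note c = cornersD[OF b[unfolded bij]]
  obtain B where B: "B = A \<or> B = A - {b}" "B \<in> states" "T \<in> J_part B ms k d"
    using T A corner_notin[OF b A] by blast
  have tab: "weak_set_valued_tableau (B - Nu) T" using B by (simp add: J_part_def)
  note t = tab[unfolded weak_set_valued_tableau_iff]
  have le: "v \<le> N" if "v \<in># T x" for v x using B that unfolding J_part_def N_def by blast
  have diag: "d + p \<le> q + L" if "N \<in># T (p, q)" for p q using B that by (auto simp: J_part_def N_def)
  have bLam: "b \<in> Lam" using c A by (auto simp: bij states_def)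
  have "(i, Suc j) \<notin> B - Nu" "(Suc i, j) \<notin> B - Nu" using c B(1) by auto
  then have "T (i, Suc j) = {#}" "T (Suc i, j) = {#}" using t by blast+
  then have right: "x \<notin># T (i, Suc j)" and below: "x \<notin># T (Suc i, j)" for x by simp_all
  \<comment> \<open>Now rows are strict: the box to the left of \<open>b\<close> is on diagonal
    \<open>d - 1\<close>, where \<open>N\<close> does not occur; entries already in \<open>b\<close>
    separate as before.\<close>
  have left: "x < N" if x: "x \<in># T (i, q)" and q: "j = Suc q" for x q
  proof -
    have "x \<noteq> N" if "T b = {#}" using diag[of i q] x q c by auto
    moreover have "x < N" if "y \<in># T b" for y
      using t x q that le[OF that] bij by (metis less_le_trans)
    ultimately show ?thesis using le[OF x] by (metis le_neq_implies_less multiset_nonemptyE)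
  qed
  let ?T = "T(b := add_mset N (T b))"
  have "weak_set_valued_tableau (A - Nu) ?T"
    unfolding weak_set_valued_tableau_iff
  proof (intro conjI allI impI)
    fix x
    have "T x \<noteq> {#} \<longleftrightarrow> x \<in> B - Nu" using t by blast
    then show "?T x \<noteq> {#} \<longleftrightarrow> x \<in> A - Nu"
      using B(1) corner_notin[OF b A] by (cases "x = b") auto
  next
    fix x
    have "0 \<notin># T x" using t by blast
    then show "0 \<notin># ?T x" by (auto simp: N_def)
  next
    fix p q x y assume "x \<in># ?T (p, q)" "y \<in># ?T (p, Suc q)"
    then show "x < y" using t left right by (auto simp: bij split: if_splits)
  next
    fix p q x y assume "x \<in># ?T (p, q)" "y \<in># ?T (Suc p, q)"
    then show "x \<le> y" using t le below by (auto simp: bij split: if_splits)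
  qed
  moreover have "(\<Sum>x\<in>Lam. count (?T x) (Suc l)) = ms ! l" if "l < length ms" for l
  proof -
    have "(\<Sum>x\<in>Lam. count (?T x) (Suc l)) = (\<Sum>x\<in>Lam. count (T x) (Suc l))"
      using that by (intro sum.cong) (auto simp: N_def)
    then show ?thesis using B that by (simp add: J_part_def)
  qed
  moreover have "(\<Sum>x\<in>Lam. count (?T x) N) = Suc k"
  proof -
    have "(\<Sum>x\<in>Lam. count (?T x) N) = (\<Sum>x\<in>Lam. count (T x) N + (if x = b then 1 else 0))"
      by (intro sum.cong) auto
    then show ?thesis using B bLam finite_Lam by (simp add: J_part_def N_def sum.distrib)
  qed
  moreover have "v \<le> N" if "v \<in># ?T x" for v x using le[of v x] le[of v b] that by (auto split: if_splits)
  moreover have "d + p \<le> q + L" if "N \<in># ?T (p, q)" for p q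
    using diag[of p q] that c by (auto simp: bij split: if_splits)
  moreover have "\<not> Suc d + i \<le> j + L" "N \<in># ?T (i, j)" using c by (simp_all add: bij)
  ultimately show "?T \<in> J_part A ms (Suc k) d - J_part A ms (Suc k) (Suc d)"
    unfolding J_part_def N_def by blast
qed

lemma J_part_remove:
  assumes A: "A \<in> states" and T: "T \<in> J_part A ms k d - J_part A ms k (Suc d)"
  defines "N \<equiv> Suc (length ms)"
  obtains b where "b \<in> corners d A" "N \<in># T b" "k > 0"
    "T(b := T b - {#N#}) \<in> J_part A ms (k - 1) d \<union> J_part (A - {b}) ms (k - 1) d"
proof -
  have tab: "weak_set_valued_tableau (A - Nu) T" using T by (simp add: J_part_def)
  note t = tab[unfolded weak_set_valued_tableau_iff]
  have le: "v \<le> N" if "v \<in># T x" for v x using T that unfolding J_part_def N_def by blast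
  have diag: "d + p \<le> q + L" if "N \<in># T (p, q)" for p q using T that by (auto simp: J_part_def N_def)
  obtain i j where ij: "N \<in># T (i, j)" "\<not> Suc d + i \<le> j + L"
    using T unfolding J_part_def N_def by blast
  have 1: "j + L = d + i" "(i, j) \<in> A - Nu"
    using diag[OF ij(1)] ij weak_set_valued_tableau_mem[OF tab] by auto
  have "(i, Suc j) \<notin> Nu" "(Suc i, j) \<notin> Nu"
    using 1 order_idealD[OF Nu_ideal, of i "Suc j" i j] order_idealD[OF Nu_ideal, of "Suc i" j i j] by auto
  moreover have "(i, Suc j) \<notin> A - Nu"
  proof
    assume "(i, Suc j) \<in> A - Nu"
    then obtain y where y: "y \<in># T (i, Suc j)" using t by (metis multiset_nonemptyE)
    then have "N < y" using t ij(1) by blast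
    then show False using le[OF y] by simp
  qed
  moreover have "(Suc i, j) \<notin> A - Nu"
  proof
    assume "(Suc i, j) \<in> A - Nu"
    then obtain y where y: "y \<in># T (Suc i, j)" using t by (metis multiset_nonemptyE)
    then have "N \<le> y" using t ij(1) by blast
    then have "N \<in># T (Suc i, j)" using le[OF y] y by simp
    then show False using diag 1 by fastforce
  qed
  ultimately have corner: "(i, j) \<in> corners d A" using 1 by (simp add: corners_def)
  define b where "b = (i, j)"
  have b: "b \<in> corners d A" "N \<in># T b" using corner ij by (simp_all add: b_def)
  have bLam: "b \<in> Lam" using corner_notin[OF b(1) A] A by (auto simp: states_def)
  have k: "k = (\<Sum>x\<in>Lam. count (T x) N)" using T by (simp add: J_part_def N_def)
  let ?T = "T(b := T b - {#N#})"
  define B where "B = (if T b = {#N#} then A - {b} else A)"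
  have "(\<Sum>x\<in>Lam. count (T x) N) = (\<Sum>x\<in>Lam. count (?T x) N + (if x = b then 1 else 0))"
    using b(2) by (intro sum.cong) auto
  then have k': "k = Suc (\<Sum>x\<in>Lam. count (?T x) N)"
    unfolding k using bLam finite_Lam by (simp add: sum.distrib)
  have mem: "v \<in># T x" if "v \<in># ?T x" for v x using that by (auto split: if_splits dest: in_diffD)
  have "weak_set_valued_tableau (B - Nu) ?T"
    unfolding weak_set_valued_tableau_iff
  proof (intro conjI allI impI)
    fix x
    have "T x \<noteq> {#} \<longleftrightarrow> x \<in> A - Nu" using t by blast
    moreover have "T b - {#N#} = {#} \<longleftrightarrow> T b = {#N#}"
      using b(2) by (metis add_mset_diff_bothsides diff_empty insert_DiffM)
    ultimately show "?T x \<noteq> {#} \<longleftrightarrow> x \<in> B - Nu"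
      using b by (cases "x = b") (auto simp: B_def)
  next
    fix x show "0 \<notin># ?T x" using t mem by blast
  next
    fix p q x y assume "x \<in># ?T (p, q)" "y \<in># ?T (p, Suc q)"
    then show "x < y" using t mem by blast
  next
    fix p q x y assume "x \<in># ?T (p, q)" "y \<in># ?T (Suc p, q)"
    then show "x \<le> y" using t mem by blast
  qed
  moreover have "(\<Sum>x\<in>Lam. count (?T x) (Suc l)) = ms ! l" if "l < length ms" for l
  proof -
    have "(\<Sum>x\<in>Lam. count (?T x) (Suc l)) = (\<Sum>x\<in>Lam. count (T x) (Suc l))"
      using that by (intro sum.cong) (auto simp: N_def)
    then show ?thesis using T that by (simp add: J_part_def)
  qed
  moreover have "(\<Sum>x\<in>Lam. count (?T x) N) = k - 1" using k' by simp
  moreover have "v \<le> N" if "v \<in># ?T x" for v x using le mem[OF that] .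
  moreover have "d + p \<le> q + L" if "N \<in># ?T (p, q)" for p q using diag mem[OF that] .
  ultimately have "?T \<in> J_part B ms (k - 1) d"
    unfolding J_part_def N_def by blast
  then show thesis using that b k' by (auto simp: B_def split: if_splits)
qed

lemma J_part_mono: "J_part A ms k (Suc d) \<subseteq> J_part A ms k d"
  unfolding J_part_def by (fastforce dest: Suc_leD)

lemma J_part_0: "A \<in> states \<Longrightarrow> J_part A ms 0 d = J_part A ms 0 (Suc d)"
  using J_part_remove[of A _ ms 0 d] J_part_mono[of A ms 0 d] by blast

lemma J_part_no_corner: "A \<in> states \<Longrightarrow> corners d A = {} \<Longrightarrow> J_part A ms k d = J_part A ms k (Suc d)"
  using J_part_remove[of A _ ms k d] J_part_mono[of A ms k d] by blast

lemma J_part_corner: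
  assumes A: "A \<in> states" and b: "b \<in> corners d A"
  shows "bij_betw (\<lambda>T. T(b := add_mset (Suc (length ms)) (T b)))
    (J_part A ms k d \<union> J_part (A - {b}) ms k d) (J_part A ms (Suc k) d - J_part A ms (Suc k) (Suc d))"
proof (rule bij_betw_byWitness[where f' = "\<lambda>T. T(b := T b - {#Suc (length ms)#})"])
  have rem: "Suc (length ms) \<in># T b \<and> T(b := T b - {#Suc (length ms)#}) \<in> J_part A ms k d \<union> J_part (A - {b}) ms k d"
    if T: "T \<in> J_part A ms (Suc k) d - J_part A ms (Suc k) (Suc d)" for T
  proof -
    obtain b' where "b' \<in> corners d A" "Suc (length ms) \<in># T b'"
      "T(b' := T b' - {#Suc (length ms)#}) \<in> J_part A ms k d \<union> J_part (A - {b'}) ms k d"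
      using J_part_remove[OF A T] by auto
    moreover from this have "b' = b" using corners_unique[OF states_ideal[OF A] b] by auto
    ultimately show ?thesis by blast
  qed
  then show "\<forall>T\<in>J_part A ms (Suc k) d - J_part A ms (Suc k) (Suc d).
      (T(b := T b - {#Suc (length ms)#}))(b := add_mset (Suc (length ms)) ((T(b := T b - {#Suc (length ms)#})) b)) = T"
    by auto
  show "(\<lambda>T. T(b := T b - {#Suc (length ms)#})) ` (J_part A ms (Suc k) d - J_part A ms (Suc k) (Suc d)) \<subseteq>
      J_part A ms k d \<union> J_part (A - {b}) ms k d"
    using rem by blast
  show "\<forall>T\<in>J_part A ms k d \<union> J_part (A - {b}) ms k d.
      (T(b := add_mset (Suc (length ms)) (T b)))(b := (T(b := add_mset (Suc (length ms)) (T b))) b - {#Suc (length ms)#}) = T"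
    by auto
  show "(\<lambda>T. T(b := add_mset (Suc (length ms)) (T b))) ` (J_part A ms k d \<union> J_part (A - {b}) ms k d) \<subseteq>
      J_part A ms (Suc k) d - J_part A ms (Suc k) (Suc d)"
    using J_part_add[OF A b] by blast
qed

lemma J_part_disjoint:
  assumes "A \<in> states" "b \<in> corners d A"
  shows "J_part A ms k d \<inter> J_part (A - {b}) ms k d = {}"
proof -
  have "T b \<noteq> {#}" if "T \<in> J_part A ms k d" for T
    using that corner_notin[OF assms(2,1)] unfolding J_part_def weak_set_valued_tableau_iff by blast
  moreover have "T b = {#}" if "T \<in> J_part (A - {b}) ms k d" for T
    using that unfolding J_part_def weak_set_valued_tableau_iff by blast
  ultimately show ?thesis by blast
qed

text \<open>Lowering \<open>k\<close> keeps \<open>d\<close>, because the letter may enter the same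
  box again; this is the recursion of \<open>(1 - x u_d)^(-1)\<close>.\<close>

lemma J_part_step:
  assumes A: "A \<in> states" and fin: "finite (J_part A ms k (Suc d))"
    and fin': "\<And>B k'. B \<in> states \<Longrightarrow> k = Suc k' \<Longrightarrow> finite (J_part B ms k' d)"
  shows "finite (J_part A ms k d) \<and> int (card (J_part A ms k d)) = int (card (J_part A ms k (Suc d)))
    + (if k = 0 then 0 else box_op d (\<lambda>B. int (card (J_part B ms (k - 1) d))) A)"
proof -
  consider "k = 0" | "corners d A = {}" | k' b where "k = Suc k'" "b \<in> corners d A"
    using not0_implies_Suc by blast
  then show ?thesis
  proof cases
    case 1
    then show ?thesis using A fin by (simp add: J_part_0[OF A, of ms d])
  next
    case 2
    then show ?thesis using A fin J_part_no_corner[OF A 2, of ms k] by (simp add: box_op_def)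
  next
    case 3
    let ?X = "J_part A ms k d - J_part A ms k (Suc d)"
    have "A - {b} \<in> states" using corner_notin[OF 3(2) A] by blast
    then have fins: "finite (J_part A ms k' d)" "finite (J_part (A - {b}) ms k' d)"
      using fin' A 3(1) by auto
    have bij: "bij_betw (\<lambda>T. T(b := add_mset (Suc (length ms)) (T b)))
        (J_part A ms k' d \<union> J_part (A - {b}) ms k' d) ?X"
      unfolding 3(1) by (rule J_part_corner[OF A 3(2)])
    have "finite ?X" using bij_betw_finite[OF bij] fins by simp
    moreover have "card ?X = card (J_part A ms k' d) + card (J_part (A - {b}) ms k' d)"
      using bij_betw_same_card[OF bij] card_Un_disjoint[OF fins J_part_disjoint[OF A 3(2)]] by simp
    moreover have "J_part A ms k d = J_part A ms k (Suc d) \<union> ?X" using J_part_mono by blast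
    moreover have "box_op d (\<lambda>B. int (card (J_part B ms (k - 1) d))) A =
        int (card (J_part A ms k' d)) + int (card (J_part (A - {b}) ms k' d))"
      unfolding box_op_def using A corners_unique[OF states_ideal[OF A] 3(2)] by (simp add: 3(1))
    moreover have "card (J_part A ms k (Suc d) \<union> ?X) = card (J_part A ms k (Suc d)) + card ?X"
      using fin \<open>finite ?X\<close> by (intro card_Un_disjoint) auto
    ultimately show ?thesis using fin 3(1) by simp
  qed
qed

text \<open>\<open>J_part_step\<close> leads to a smaller \<open>k\<close> at the same
  \<open>d\<close> or a larger \<open>d\<close> at the same \<open>k\<close>, hence an outer
  induction on \<open>k\<close> and an inner one downwards from \<open>2 * L\<close>.\<close>

lemma J_part_finite:
  assumes "\<And>B. B \<in> states \<Longrightarrow> finite (J_tabs B ms)" "A \<in> states" "d \<le> 2 * L"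
  shows "finite (J_part A ms k d)"
  using assms(2,3)
proof (induction k arbitrary: A d)
  case 0
  from 0(2) show ?case
  proof (induction d rule: inc_induct)
    case base
    then show ?case using assms(1) 0 by (simp add: J_part_last)
  next
    case (step d)
    then show ?case using J_part_step[OF 0(1) step(3)] by simp
  qed
next
  case (Suc k)
  from Suc(3) show ?case
  proof (induction d rule: inc_induct)
    case base
    then show ?case using Suc by (simp add: J_part_last)
  next
    case (step d)
    then have "d \<le> 2 * L" by simp
    show ?case using J_part_step[OF Suc(2) step(3)] Suc(1)[OF _ \<open>d \<le> 2 * L\<close>] by blast
  qed
qed

lemma box_op_cong: "(\<And>B. B \<in> states \<Longrightarrow> g B = g' B) \<Longrightarrow> box_op d g A = box_op d g' A"
  unfolding box_op_def using corner_notin by (auto intro!: sum.cong)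

text \<open>The generating function of weak tableaux inverts the operator \<open>strip_op\<close> at \<open>-x\<close>, because a letter is
  inserted along the diagonals in the opposite order and with arbitrary multiplicity.\<close>

lemma J_part_inverse:
  assumes fin: "\<And>B. B \<in> states \<Longrightarrow> finite (J_tabs B ms)" and A: "A \<in> states" and d: "d \<le> 2 * L"
  shows "(\<Sum>j\<le>n. (-1) ^ j * strip_op d (int j) (\<lambda>B. int (card (J_part B ms (n - j) 0))) A) = int (card (J_part A ms n d))"
  using A d
proof (induction d arbitrary: A n)
  case 0
  then show ?case by (simp add: sum.atMost_shift)
next
  case (Suc d)
  define g where "g k = (\<lambda>B. int (card (J_part B ms k 0)))" for k
  have IH: "(\<Sum>j\<le>n. (-1) ^ j * strip_op d (int j) (g (n - j)) B) = int (card (J_part B ms n d))" if "B \<in> states" for B n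
    using Suc that by (simp add: g_def)
  \<comment> \<open>The contribution of \<open>- x u_d\<close> in the additional factor
    \<open>1 - x u_d\<close>; by \<open>J_part_step\<close> it turns the count at \<open>d\<close>
    into that at \<open>Suc d\<close>.\<close>
  have "(\<Sum>j\<le>n. (-1) ^ j * box_op d (strip_op d (int j - 1) (g (n - j))) A) =
      - (if n = 0 then 0 else box_op d (\<lambda>B. int (card (J_part B ms (n - 1) d))) A)"
  proof (cases n)
    case 0
    have "strip_op d (- 1) (g 0) = (\<lambda>B. 0)" by (simp add: fun_eq_iff strip_op_neg)
    then show ?thesis by (simp add: 0 box_op_zero)
  next
    case (Suc m)
    have "strip_op d (- 1) (g (Suc m)) = (\<lambda>B. 0)" by (simp add: fun_eq_iff strip_op_neg)
    then have "(\<Sum>j\<le>n. (-1) ^ j * box_op d (strip_op d (int j - 1) (g (n - j))) A) =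
        - (\<Sum>j\<le>m. (-1) ^ j * box_op d (strip_op d (int j) (g (m - j))) A)"
      by (simp add: Suc sum.atMost_Suc_shift box_op_zero sum_negf del: sum.atMost_Suc)
    also have "\<dots> = - box_op d (\<lambda>B. \<Sum>j\<le>m. (-1) ^ j * strip_op d (int j) (g (m - j)) B) A"
      by (simp add: linear_opD[OF box_op_linear])
    also have "\<dots> = - box_op d (\<lambda>B. int (card (J_part B ms m d))) A"
      by (intro arg_cong[of _ _ uminus] box_op_cong IH)
    finally show ?thesis by (simp add: Suc)
  qed
  moreover have "int (card (J_part A ms n d)) = int (card (J_part A ms n (Suc d)))
    + (if n = 0 then 0 else box_op d (\<lambda>B. int (card (J_part B ms (n - 1) d))) A)"
    using J_part_step[OF Suc.prems(1), of ms n d] J_part_finite[OF fin] Suc.prems by simp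
  ultimately show ?case
    using IH[OF Suc.prems(1), of n] by (simp add: distrib_left sum.distrib flip: g_def)
qed

text \<open>At \<open>d = 2 * L\<close>, \<open>J_part_inverse\<close> says that
  \<open>U(-x)\<close> sends the counts with the largest letter to those without it; solving for the
  former is the recursion of \<open>weak_op\<close>.\<close>

lemma J_part_h:
  assumes fin: "\<And>B. B \<in> states \<Longrightarrow> finite (J_tabs B ms)" and A: "A \<in> states"
  shows "int (card (J_part A ms n 0)) = weak_op n (\<lambda>B. int (card (J_tabs B ms))) A"
  using A
proof (induction n arbitrary: A rule: less_induct)
  case (less n)
  define g where "g k = (\<lambda>B. int (card (J_part B ms k 0)))" for k
  have eq: "(\<Sum>j\<le>n. (-1) ^ j * strip_op (2 * L) (int j) (g (n - j)) A) = (if n = 0 then int (card (J_tabs A ms)) else 0)"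
    using J_part_inverse[OF fin less.prems, of "2 * L" n] J_part_last[OF less.prems] by (simp add: g_def)
  show ?case
  proof (cases n)
    case 0
    then show ?thesis using eq by (simp add: strip_op_0 g_def)
  next
    case (Suc m)
    have "g n A = (\<Sum>j\<le>m. (-1) ^ j * strip_op (2 * L) (int (Suc j)) (g (m - j)) A)"
      using eq by (simp add: Suc sum.atMost_Suc_shift strip_op_0 sum_negf del: sum.atMost_Suc)
    also have "\<dots> = (\<Sum>j\<le>m. (-1) ^ j * strip_op (2 * L) (int (Suc j)) (weak_op (m - j) (\<lambda>B. int (card (J_tabs B ms)))) A)"
      using less by (intro sum.cong refl arg_cong2[of _ _ _ _ "(*)"] strip_op_cong) (auto simp: g_def Suc)
    finally show ?thesis unfolding Suc weak_op.simps g_def .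
  qed
qed

lemma weak_op_cong:
  assumes "\<And>B. B \<in> states \<Longrightarrow> g B = g' B" "A \<in> states"
  shows "weak_op n g A = weak_op n g' A"
  using assms(2)
proof (induction n arbitrary: A rule: less_induct)
  case (less n)
  show ?case
  proof (cases n)
    case (Suc m)
    show ?thesis
      unfolding Suc weak_op.simps
      by (intro sum.cong refl arg_cong2[of _ _ _ _ "(*)"] strip_op_cong) (use less Suc in auto)
  qed (use less assms in simp)
qed

lemma J_tabs_card:
  "A \<in> states \<Longrightarrow> finite (J_tabs A as) \<and> int (card (J_tabs A as)) = weak_word (rev as) A"
proof (induction as arbitrary: A rule: rev_induct)
  case Nil
  then show ?case by (simp add: tabs_empty start_def)
next
  case (snoc k as)
  have "finite (J_part A as k 0)" using snoc by (intro J_part_finite) auto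
  moreover have "int (card (J_part A as k 0)) = weak_op k (\<lambda>B. int (card (J_tabs B as))) A"
    using snoc by (intro J_part_h) auto
  ultimately show ?case
    using snoc weak_op_cong[of "\<lambda>B. int (card (J_tabs B as))" "weak_word (rev as)" A] by (simp add: J_part_first)
qed

end

section \<open>Symmetric functions and their exponent lists\<close>
definition exponents :: "monomial \<Rightarrow> nat multiset" where
  "exponents m = image_mset (Poly_Mapping.lookup m) (mset_set (Poly_Mapping.keys m))"

text \<open>\<open>Poly_Mapping.degree\<close> is one more than the largest position in use (0 if
  there is none), unlike the total degree \<open>deg\<close>; the result is the exponent vector
  without trailing zeros.\<close>

definition exponent_list :: "monomial \<Rightarrow> nat list" where
  "exponent_list m = map (Poly_Mapping.lookup m) [0..<Poly_Mapping.degree m]"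

lemma nth_exponent_list [simp]: "Poly_Mapping.nth (exponent_list m) = m"
  unfolding exponent_list_def by (rule nth_idem)

lemma lookup_map_key: "inj p \<Longrightarrow> Poly_Mapping.lookup (Poly_Mapping.map_key p m) = (\<lambda>i. Poly_Mapping.lookup m (p i))"
  by (simp add: map_key.rep_eq o_def)

lemma exponents_map_key:
  assumes "bij p"
  shows "exponents (Poly_Mapping.map_key p m) = exponents m"
proof -
  have p: "inj p" "surj p" using assms by (auto simp: bij_def)
  have "exponents (Poly_Mapping.map_key p m) =
      image_mset (Poly_Mapping.lookup m) (image_mset p (mset_set (p -` Poly_Mapping.keys m)))"
    by (simp add: exponents_def keys_map_key p lookup_map_key image_mset.compositionality o_def)
  also have "image_mset p (mset_set (p -` Poly_Mapping.keys m)) = mset_set (Poly_Mapping.keys m)"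
    using image_mset_mset_set[of p "p -` Poly_Mapping.keys m"] p surj_image_vimage_eq[of p]
    by (simp add: inj_on_subset)
  finally show ?thesis by (simp add: exponents_def)
qed

lemma exponents_nth: "exponents (Poly_Mapping.nth as) = {#x \<in># mset as. x \<noteq> 0#}"
proof -
  have keys: "Poly_Mapping.keys (Poly_Mapping.nth as) = {i \<in> {..<length as}. as ! i \<noteq> 0}"
    by (auto simp: in_keys_iff nth_default_def simp del: keys_nth split: if_splits)
  have "mset as = image_mset (\<lambda>i. as ! i) (mset_set {..<length as})"
    by (metis lessThan_atLeast0 map_nth mset_map mset_upt)
  then have "{#x \<in># mset as. x \<noteq> 0#} = image_mset (\<lambda>i. as ! i) (mset_set (Poly_Mapping.keys (Poly_Mapping.nth as)))"
    by (simp add: filter_mset_image_mset keys del: keys_nth)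
  also have "\<dots> = exponents (Poly_Mapping.nth as)"
    unfolding exponents_def by (rule image_mset_cong) (auto simp: keys nth_default_def simp del: keys_nth)
  finally show ?thesis by simp
qed

lemma deg_exponents: "deg m = sum_mset (exponents m)"
  by (simp add: deg_def exponents_def sum_unfold_sum_mset)

lemma card_keys_exponents: "card (Poly_Mapping.keys m) = size (exponents m)"
  by (simp add: exponents_def)

lemma sum_mset_filter_nonzero: "sum_mset {#x \<in># M. x \<noteq> (0 :: nat)#} = sum_mset M"
  by (induction M) auto

lemma deg_nth: "deg (Poly_Mapping.nth as) = sum_list as"
  unfolding deg_exponents exponents_nth sum_mset_filter_nonzero by (rule sum_mset_sum_list)

lemma size_exponents_le_deg: "size (exponents m) \<le> deg m"
proof -
  have "size M \<le> sum_mset M" if "0 \<notin># M" for M :: "nat multiset"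
    using that by (induction M) auto
  moreover have "0 \<notin># exponents m" by (auto simp: exponents_def in_keys_iff)
  ultimately show ?thesis by (simp add: deg_exponents)
qed

lemma mset_eq_if_filter_eq:
  assumes "filter_mset (\<lambda>x. x \<noteq> a) M = filter_mset (\<lambda>x. x \<noteq> a) M'" "size M = size M'"
  shows "M = M'"
proof -
  have *: "M = {#x \<in># M. x \<noteq> a#} + replicate_mset (size M - size {#x \<in># M. x \<noteq> a#}) a" for M
  proof -
    have "M = {#x \<in># M. x \<noteq> a#} + replicate_mset (count M a) a"
      using multiset_partition[of M "\<lambda>x. x \<noteq> a"] filter_eq_replicate_mset[of a M] by simp
    then show ?thesis by (metis add_diff_cancel_left' size_replicate_mset size_union)
  qed
  show ?thesis by (subst *[of M], subst *[of M']) (simp add: assms)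
qed

text \<open>Padding both exponent vectors to a common length makes their numbers of zeros agree too;
  a permutation of the positions then extends by the identity to a bijection of all
  variables.\<close>

lemma symmetric_exponents:
  assumes "symmetric f" "exponents m = exponents m'"
  shows "f m = f m'"
proof -
  define n where "n = max (Poly_Mapping.degree m) (Poly_Mapping.degree m')"
  define as where "as = map (Poly_Mapping.lookup m) [0..<n]"
  define bs where "bs = map (Poly_Mapping.lookup m') [0..<n]"
  have nth: "Poly_Mapping.nth as = m" "Poly_Mapping.nth bs = m'"
    unfolding as_def bs_def by (simp_all add: nth_idem_bound n_def)
  have len: "length as = length bs" by (simp add: as_def bs_def)
  have "mset as = mset bs"
  proof (rule mset_eq_if_filter_eq[of 0])
    show "{#x \<in># mset as. x \<noteq> 0#} = {#x \<in># mset bs. x \<noteq> 0#}"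
      using assms(2) unfolding exponents_nth[symmetric] nth .
  qed (simp add: len)
  then obtain p where p: "p permutes {..<length bs}" "permute_list p bs = as"
    by (rule mset_eq_permutation)
  have "Poly_Mapping.nth as = Poly_Mapping.map_key p (Poly_Mapping.nth bs)"
  proof (rule poly_mapping_eqI)
    fix i
    have "nth_default 0 (permute_list p bs) i = nth_default 0 bs (p i)"
      using permutes_in_image[OF p(1), of i] permutes_not_in[OF p(1), of i] permute_list_nth[OF p(1), of i]
      by (cases "i < length bs") (auto simp: nth_default_def)
    then show "Poly_Mapping.lookup (Poly_Mapping.nth as) i =
        Poly_Mapping.lookup (Poly_Mapping.map_key p (Poly_Mapping.nth bs)) i"
      using p by (simp add: lookup_map_key permutes_inj)
  qed
  then show ?thesis
    using assms(1) permutes_bij[OF p(1)] by (simp add: symmetric_def nth)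
qed

lemma symmetricI: "(\<And>m m'. exponents m = exponents m' \<Longrightarrow> f m = f m') \<Longrightarrow> symmetric f"
  unfolding symmetric_def by (blast intro: exponents_map_key)

definition list_series :: "pseries \<Rightarrow> nat list \<Rightarrow> int" where
  "list_series f as = f (Poly_Mapping.nth as)"

lemma sym_list_list_series:
  assumes "symmetric f"
  shows "sym_list (list_series f)"
  unfolding sym_list_def list_series_def
  by (intro conjI allI impI symmetric_exponents[OF assms]) (simp_all add: exponents_nth)

lemma sym_list_filter: "sym_list \<phi> \<Longrightarrow> \<phi> as = \<phi> (filter (\<lambda>x. x \<noteq> 0) as)"
proof (induction as arbitrary: \<phi>)
  case (Cons a as)
  then show ?case
    using Cons.IH[OF Cons.prems] Cons.IH[OF sym_list_slice[OF Cons.prems, of a]] slice_0[OF Cons.prems]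
    by (cases "a = 0") (auto simp: slice_def fun_eq_iff)
qed simp

lemma sym_list_cong:
  assumes "sym_list \<phi>" "exponents (Poly_Mapping.nth as) = exponents (Poly_Mapping.nth bs)"
  shows "\<phi> as = \<phi> bs"
proof -
  have "mset (filter (\<lambda>x. x \<noteq> 0) as) = mset (filter (\<lambda>x. x \<noteq> 0) bs)"
    using assms(2) by (simp add: exponents_nth)
  then have "\<phi> (filter (\<lambda>x. x \<noteq> 0) as) = \<phi> (filter (\<lambda>x. x \<noteq> 0) bs)"
    using assms(1) unfolding sym_list_def by blast
  then show ?thesis using sym_list_filter[OF assms(1)] by metis
qed

lemma symmetric_exponent_list:
  assumes "sym_list \<phi>"
  shows "symmetric (\<lambda>m. \<phi> (exponent_list m))"
  by (rule symmetricI, rule sym_list_cong[OF assms]) simp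

section \<open>Products on monomials and on exponent lists\<close>

fun splits :: "nat list \<Rightarrow> (nat list \<times> nat list) set" where
  "splits [] = {([], [])}"
| "splits (n # as) = (\<lambda>(k, bs, cs). (k # bs, (n - k) # cs)) ` ({..n} \<times> splits as)"

lemma mem_splits:
  "(bs, cs) \<in> splits as \<longleftrightarrow> length bs = length as \<and> length cs = length as \<and> (\<forall>i<length as. bs ! i + cs ! i = as ! i)"
proof (induction as arbitrary: bs cs)
  case (Cons n as)
  have "(bs, cs) \<in> splits (n # as) \<longleftrightarrow>
      (\<exists>b bs' c cs'. bs = b # bs' \<and> cs = c # cs' \<and> b + c = n \<and> (bs', cs') \<in> splits as)"
    by (force simp: image_iff)
  also have "\<dots> \<longleftrightarrow> length bs = length (n # as) \<and> length cs = length (n # as) \<and>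
      (\<forall>i<length (n # as). bs ! i + cs ! i = (n # as) ! i)"
    by (auto simp: Cons.IH All_less_Suc2 length_Suc_conv)
  finally show ?case .
qed simp

lemma finite_splits: "finite (splits as)"
  by (induction as) auto

lemma list_conv_splits: "list_conv \<phi> \<psi> as = (\<Sum>(bs, cs)\<in>splits as. \<phi> bs * \<psi> cs)"
proof (induction as arbitrary: \<phi> \<psi>)
  case (Cons n as)
  have "inj_on (\<lambda>(k, bs, cs). (k # bs, (n - k) # cs)) ({..n} \<times> splits as)"
    by (auto simp: inj_on_def)
  then have "(\<Sum>(bs, cs)\<in>splits (n # as). \<phi> bs * \<psi> cs) =
      (\<Sum>(k, bs, cs)\<in>{..n} \<times> splits as. \<phi> (k # bs) * \<psi> ((n - k) # cs))"
    by (simp add: sum.reindex case_prod_unfold o_def)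
  then show ?case
    by (simp add: Cons.IH sum.cartesian_product slice_def case_prod_unfold)
qed simp

lemma nth_inject_length:
  assumes "length as = length bs" "Poly_Mapping.nth as = Poly_Mapping.nth (bs :: nat list)"
  shows "as = bs"
proof (rule nth_equalityI)
  fix i assume "i < length as"
  moreover have "nth_default 0 as i = nth_default 0 bs i"
    using assms(2) by (metis lookup_nth)
  ultimately show "as ! i = bs ! i" using assms(1) by (simp add: nth_default_def)
qed (fact assms(1))

text \<open>A factor of a monomial uses no variable beyond the list, so both factors can be written
  as lists of that same length.\<close>

lemma splits_bij:
  "bij_betw (\<lambda>(bs, cs). (Poly_Mapping.nth bs, Poly_Mapping.nth cs)) (splits as) {(a, b). a + b = Poly_Mapping.nth as}"
  unfolding bij_betw_def
proof
  show "inj_on (\<lambda>(bs, cs). (Poly_Mapping.nth bs, Poly_Mapping.nth cs)) (splits as)"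
    by (auto simp: inj_on_def mem_splits intro: nth_inject_length)
  have "Poly_Mapping.nth bs + Poly_Mapping.nth cs = Poly_Mapping.nth as" if "(bs, cs) \<in> splits as" for bs cs
    using that by (intro poly_mapping_eqI) (auto simp: lookup_add nth_default_def mem_splits)
  moreover have "(a, b) \<in> (\<lambda>(bs, cs). (Poly_Mapping.nth bs, Poly_Mapping.nth cs)) ` splits as"
    if ab: "a + b = Poly_Mapping.nth as" for a b
  proof -
    have look: "Poly_Mapping.lookup a i + Poly_Mapping.lookup b i = nth_default 0 as i" for i
      by (metis ab lookup_add lookup_nth)
    have nth: "Poly_Mapping.nth (map (Poly_Mapping.lookup c) [0..<length as]) = c"
      if "\<And>i. i \<ge> length as \<Longrightarrow> Poly_Mapping.lookup c i = 0" for c :: monomial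
      using that by (intro poly_mapping_eqI) (simp add: nth_default_def)
    have "Poly_Mapping.nth (map (Poly_Mapping.lookup a) [0..<length as]) = a"
      "Poly_Mapping.nth (map (Poly_Mapping.lookup b) [0..<length as]) = b"
      by (rule nth; use look in \<open>metis add_is_0 nth_default_beyond\<close>)+
    moreover have "(map (Poly_Mapping.lookup a) [0..<length as], map (Poly_Mapping.lookup b) [0..<length as]) \<in> splits as"
      using look by (auto simp: mem_splits nth_default_def)
    ultimately show ?thesis by (force simp: image_iff)
  qed
  ultimately show "(\<lambda>(bs, cs). (Poly_Mapping.nth bs, Poly_Mapping.nth cs)) ` splits as = {(a, b). a + b = Poly_Mapping.nth as}"
    by auto
qed

definition smult :: "pseries \<Rightarrow> pseries \<Rightarrow> pseries" where
  "smult f g m = (\<Sum>(a, b)\<in>{(a, b). a + b = m}. f a * g b)"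

lemma list_series_smult: "list_series (smult f g) as = list_conv (list_series f) (list_series g) as"
  unfolding list_series_def smult_def list_conv_splits
  using sum.reindex_bij_betw[OF splits_bij, of "\<lambda>(a, b). f a * g b" as] by (simp add: case_prod_unfold)

lemma Sym_simps:
  "carrier Sym = {f. symmetric f \<and> bounded_degree f}" "f \<otimes>\<^bsub>Sym\<^esub> g = smult f g"
  "\<one>\<^bsub>Sym\<^esub> = (\<lambda>m. if m = 0 then 1 else 0)" "f \<oplus>\<^bsub>Sym\<^esub> g = (\<lambda>m. f m + g m)"
  by (simp_all add: Sym_def smult_def fun_eq_iff)

lemma deg_add: "deg (a + b) = deg a + deg b"
proof -
  have deg: "deg m = (\<Sum>i\<in>Poly_Mapping.keys a \<union> Poly_Mapping.keys b. Poly_Mapping.lookup m i)"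
    if "Poly_Mapping.keys m \<subseteq> Poly_Mapping.keys a \<union> Poly_Mapping.keys b" for m
    unfolding deg_def using that by (intro sum.mono_neutral_left) (auto simp: in_keys_iff)
  show ?thesis
    using Poly_Mapping.keys_add[of a b] by (simp add: deg lookup_add sum.distrib)
qed

lemma smult_nonzero:
  assumes "smult f g m \<noteq> 0"
  obtains a b where "a + b = m" "f a \<noteq> 0" "g b \<noteq> 0"
proof -
  have "\<exists>x\<in>{(a, b). a + b = m}. (case x of (a, b) \<Rightarrow> f a * g b) \<noteq> 0"
    using assms unfolding smult_def by (meson sum.neutral)
  then show thesis using that by fastforce
qed

lemma symmetric_smult:
  assumes "symmetric f" "symmetric g"
  shows "symmetric (smult f g)"
  unfolding symmetric_def
proof (intro allI impI)
  fix p :: "nat \<Rightarrow> nat" and m assume "bij p"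
  then have p: "inj p" "inj (inv_into UNIV p)" and q: "p \<circ> inv_into UNIV p = id" "inv_into UNIV p \<circ> p = id"
    using bij_is_inj[OF bij_imp_bij_inv] by (auto simp: bij_def surj_iff inj_iff)
  have inv: "Poly_Mapping.map_key p (Poly_Mapping.map_key (inv_into UNIV p) a) = a"
    "Poly_Mapping.map_key (inv_into UNIV p) (Poly_Mapping.map_key p a) = a" for a :: monomial
    using map_key_id[of a] by (simp_all add: map_key_compose p q id_def)
  show "smult f g (Poly_Mapping.map_key p m) = smult f g m"
    unfolding smult_def
  proof (rule sum.reindex_bij_witness[of _ "\<lambda>(a, b). (Poly_Mapping.map_key p a, Poly_Mapping.map_key p b)"
        "\<lambda>(a, b). (Poly_Mapping.map_key (inv_into UNIV p) a, Poly_Mapping.map_key (inv_into UNIV p) b)"], goal_cases)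
    case (2 x)
    then show ?case by (auto simp: inv map_key_plus[OF p(2), symmetric])
  next
    case (4 x)
    then show ?case by (auto simp: map_key_plus[OF p(1)])
  next
    case (5 x)
    have "f (Poly_Mapping.map_key (inv_into UNIV p) a) = f a" "g (Poly_Mapping.map_key (inv_into UNIV p) a) = g a" for a
      using assms bij_imp_bij_inv[OF \<open>bij p\<close>] unfolding symmetric_def by blast+
    then show ?case by (simp add: case_prod_unfold)
  qed (auto simp: inv)
qed

lemma bounded_degree_smult:
  assumes "bounded_degree f" "bounded_degree g"
  shows "bounded_degree (smult f g)"
proof -
  obtain M N where "\<And>m. f m \<noteq> 0 \<Longrightarrow> deg m \<le> M" "\<And>m. g m \<noteq> 0 \<Longrightarrow> deg m \<le> N"
    using assms unfolding bounded_degree_def by blast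
  then have "deg m \<le> M + N" if "smult f g m \<noteq> 0" for m
    using that by (metis smult_nonzero deg_add add_mono)
  then show ?thesis unfolding bounded_degree_def by blast
qed

lemma Sym_smult: "f \<in> carrier Sym \<Longrightarrow> g \<in> carrier Sym \<Longrightarrow> smult f g \<in> carrier Sym"
  by (simp add: Sym_simps symmetric_smult bounded_degree_smult)

lemma Sym_add:
  assumes "f \<in> carrier Sym" "g \<in> carrier Sym"
  shows "(\<lambda>m. f m + g m) \<in> carrier Sym"
proof -
  obtain M N where "\<And>m. f m \<noteq> 0 \<Longrightarrow> deg m \<le> M" "\<And>m. g m \<noteq> 0 \<Longrightarrow> deg m \<le> N"
    using assms unfolding bounded_degree_def Sym_simps by blast
  then have "deg m \<le> max M N" if "f m + g m \<noteq> 0" for m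
    using that by (metis add_0 max.coboundedI1 max.coboundedI2)
  then show ?thesis using assms unfolding Sym_simps bounded_degree_def symmetric_def by auto
qed

lemma Sym_diff:
  assumes "f \<in> carrier Sym" "g \<in> carrier Sym"
  shows "(\<lambda>m. f m - g m) \<in> carrier Sym"
proof -
  obtain M N where "\<And>m. f m \<noteq> 0 \<Longrightarrow> deg m \<le> M" "\<And>m. g m \<noteq> 0 \<Longrightarrow> deg m \<le> N"
    using assms unfolding bounded_degree_def Sym_simps by blast
  then have "deg m \<le> max M N" if "f m - g m \<noteq> 0" for m
    using that by (metis diff_self max.coboundedI1 max.coboundedI2)
  then show ?thesis using assms unfolding Sym_simps bounded_degree_def symmetric_def by auto
qed

lemma elem_sym_nth: "elem_sym k (Poly_Mapping.nth as) = elem_list k as"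
proof -
  have "(\<forall>i. nth_default 0 as i \<le> 1) \<longleftrightarrow> (\<forall>a\<in>set as. a \<le> 1)"
    by (auto simp: nth_default_def all_set_conv_all_nth)
  then show ?thesis by (simp add: elem_sym_def elem_list_def deg_nth)
qed

lemma Sym_one: "\<one>\<^bsub>Sym\<^esub> \<in> carrier Sym"
proof -
  have "m = 0 \<longleftrightarrow> exponents m = {#}" for m
    by (auto simp: exponents_def mset_set_empty_iff)
  then have "symmetric (\<lambda>m. if m = 0 then 1 else 0)" by (intro symmetricI) simp
  then show ?thesis by (auto simp: Sym_simps bounded_degree_def)
qed

lemma elem_sym_Sym: "elem_sym k \<in> carrier Sym"
proof -
  have "(\<forall>i. Poly_Mapping.lookup m i \<le> 1) \<longleftrightarrow> (\<forall>x\<in>#exponents m. x \<le> 1)" for m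
    by (auto simp: exponents_def in_keys_iff)
  then have "symmetric (elem_sym k)"
    by (intro symmetricI) (simp add: elem_sym_def deg_exponents)
  then show ?thesis by (auto simp: Sym_simps bounded_degree_def elem_sym_def)
qed

section \<open>The involution on symmetric series\<close>

definition omega_fun :: "pseries \<Rightarrow> pseries" where
  "omega_fun f m = omega_list (list_series f) (exponent_list m)"

text \<open>Reading a list back from its monomial loses trailing zeros; the invariance of
  \<open>omega_list\<close> under zeros repairs this.\<close>

lemma list_series_omega_fun:
  assumes "symmetric f"
  shows "list_series (omega_fun f) = omega_list (list_series f)"
proof
  fix as
  show "list_series (omega_fun f) as = omega_list (list_series f) as"
    unfolding list_series_def[of "omega_fun f"] omega_fun_def
    by (rule sym_list_cong[OF sym_list_omega_list[OF sym_list_list_series[OF assms]]]) simp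
qed

lemma symmetric_omega_fun: "symmetric f \<Longrightarrow> symmetric (omega_fun f)"
  using symmetric_exponent_list[OF sym_list_omega_list[OF sym_list_list_series]] by (simp add: omega_fun_def[abs_def])

lemma list_series_exponent_list: "list_series f (exponent_list m) = f m"
  by (simp add: list_series_def)

lemma list_series_homogeneous_part:
  "list_series (homogeneous_part d f) = (\<lambda>as. if sum_list as = d then list_series f as else 0)"
  by (simp add: list_series_def homogeneous_part_def deg_nth fun_eq_iff)

lemma deg_exponent_list: "sum_list (exponent_list m) = deg m"
  using deg_nth[of "exponent_list m"] by simp

lemma omega_fun_homogeneous_part:
  "omega_fun (homogeneous_part d f) m = (if deg m = d then omega_fun f m else 0)"
  by (simp add: omega_fun_def list_series_homogeneous_part omega_list_graded deg_exponent_list)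

lemma bounded_degree_omega_fun:
  assumes "bounded_degree f"
  shows "bounded_degree (omega_fun f)"
proof -
  obtain N where N: "\<And>m. f m \<noteq> 0 \<Longrightarrow> deg m \<le> N" using assms unfolding bounded_degree_def by blast
  have eq: "list_series f = (\<lambda>as. \<Sum>d\<le>N. 1 * list_series (homogeneous_part d f) as)"
    using N by (auto simp: fun_eq_iff list_series_def homogeneous_part_def)
  have "omega_fun f m = (\<Sum>d\<le>N. 1 * omega_fun (homogeneous_part d f) m)" for m
    unfolding omega_fun_def by (subst eq, rule omega_list_sum)
  then have "omega_fun f m = (if deg m \<le> N then omega_fun f m else 0)" for m
    by (simp add: omega_fun_homogeneous_part)
  then have "deg m \<le> N" if "omega_fun f m \<noteq> 0" for m using that by metis
  then show ?thesis unfolding bounded_degree_def by blast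
qed

lemma omega_fun_Sym: "f \<in> carrier Sym \<Longrightarrow> omega_fun f \<in> carrier Sym"
  by (simp add: Sym_simps symmetric_omega_fun bounded_degree_omega_fun)

lemma omega_fun_smult:
  assumes "symmetric f" "symmetric g"
  shows "omega_fun (smult f g) = smult (omega_fun f) (omega_fun g)"
proof
  fix m
  have "omega_fun (smult f g) m = omega_list (list_conv (list_series f) (list_series g)) (exponent_list m)"
    by (simp add: omega_fun_def list_series_smult[abs_def])
  also have "\<dots> = list_series (smult (omega_fun f) (omega_fun g)) (exponent_list m)"
    by (simp add: omega_list_conv sym_list_list_series assms list_series_smult list_series_omega_fun)
  finally show "omega_fun (smult f g) m = smult (omega_fun f) (omega_fun g) m"
    by (simp add: list_series_exponent_list)
qed

lemma omega_fun_add: "omega_fun (\<lambda>m. f m + g m) = (\<lambda>m. omega_fun f m + omega_fun g m)"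
  by (simp add: fun_eq_iff omega_fun_def list_series_def[abs_def] omega_list_add)

lemma omega_fun_elem_sym: "omega_fun (elem_sym k) = complete_sym k"
proof
  fix m
  have "list_series (elem_sym k) = elem_list k" by (simp add: fun_eq_iff list_series_def elem_sym_nth)
  then show "omega_fun (elem_sym k) m = complete_sym k m"
    by (simp add: omega_fun_def omega_elem_list complete_sym_def deg_exponent_list)
qed

lemma elem_sym_0: "elem_sym 0 = \<one>\<^bsub>Sym\<^esub>" and complete_sym_0: "complete_sym 0 = \<one>\<^bsub>Sym\<^esub>"
proof -
  have "deg m = 0 \<longleftrightarrow> m = 0" for m
    unfolding deg_def by (auto simp: in_keys_iff intro!: poly_mapping_eqI)
  then show "elem_sym 0 = \<one>\<^bsub>Sym\<^esub>" "complete_sym 0 = \<one>\<^bsub>Sym\<^esub>"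
    by (auto simp: Sym_simps elem_sym_def complete_sym_def fun_eq_iff)
qed

lemma omega_fun_omega_fun:
  assumes "symmetric f"
  shows "omega_fun (omega_fun f) = f"
  by (simp add: fun_eq_iff omega_fun_def[of "omega_fun f"] list_series_omega_fun assms omega_list_omega_list
      sym_list_list_series list_series_exponent_list)

text \<open>Every symmetric function is a polynomial in the elementary ones: if all monomials of \<open>f\<close> involve at
  least \<open>r\<close> variables, subtracting \<open>e\<^sub>r g\<close>, where \<open>g\<close> has the exponents of \<open>f\<close> lowered by one, leaves
  monomials with more than \<open>r\<close> variables.\<close>

definition lower :: "nat \<Rightarrow> pseries \<Rightarrow> pseries" where
  "lower r f m = (if size (exponents m) \<le> r then
     f (Poly_Mapping.nth (map Suc (sorted_list_of_multiset (exponents m) @ replicate (r - size (exponents m)) 0))) else 0)"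

lemma symmetric_lower: "symmetric (lower r f)"
  by (rule symmetricI) (simp add: lower_def)

lemma deg_lower:
  assumes "\<And>m. f m \<noteq> 0 \<Longrightarrow> deg m \<le> d" "lower r f m \<noteq> 0"
  shows "deg m + r \<le> d"
proof -
  define as where "as = sorted_list_of_multiset (exponents m) @ replicate (r - size (exponents m)) 0"
  have "sum_list (sorted_list_of_multiset (exponents m)) = deg m"
    by (metis deg_exponents mset_sorted_list_of_multiset sum_mset_sum_list)
  then have "sum_list as = deg m" by (simp add: as_def sum_list_replicate)
  moreover have "length as = r"
    using assms(2) by (auto simp: as_def lower_def size_mset[symmetric] simp del: size_mset split: if_splits)
  moreover have "sum_list (map Suc as) = sum_list as + length as" by (induction as) auto
  moreover have "sum_list (map Suc as) \<le> d"
    using assms by (auto simp: as_def[symmetric] lower_def deg_nth[symmetric] simp del: map_append split: if_splits)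
  ultimately show ?thesis by simp
qed

text \<open>Exponents equal to 1 in \<open>m\<close> become 0 in \<open>b\<close> and are lost from
  \<open>exponents b\<close>; the zeros padded in by \<open>lower\<close> restore them.\<close>

lemma lower_eq:
  assumes f: "symmetric f" and r: "card (Poly_Mapping.keys m) = r"
    and b: "\<And>i. Poly_Mapping.lookup b i = Poly_Mapping.lookup m i - 1"
  shows "lower r f b = f m"
proof -
  let ?K = "Poly_Mapping.keys m"
  have sub: "Poly_Mapping.keys b \<subseteq> ?K" by (auto simp: in_keys_iff b)
  have split: "image_mset (Poly_Mapping.lookup b) (mset_set ?K) =
      exponents b + replicate_mset (r - size (exponents b)) 0"
  proof -
    have "mset_set ?K = mset_set (Poly_Mapping.keys b) + mset_set (?K - Poly_Mapping.keys b)"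
      using sub by (metis Diff_disjoint Diff_partition finite_Diff finite_keys mset_set_Union)
    moreover have "image_mset (Poly_Mapping.lookup b) (mset_set (?K - Poly_Mapping.keys b)) =
        image_mset (\<lambda>_. 0) (mset_set (?K - Poly_Mapping.keys b))"
      by (rule image_mset_cong) (simp add: in_keys_iff)
    ultimately show ?thesis
      using sub by (simp add: exponents_def image_mset_const_eq card_Diff_subset finite_subset r)
  qed
  have le: "size (exponents b) \<le> r"
    unfolding card_keys_exponents[symmetric] r[symmetric] by (rule card_mono[OF finite_keys sub])
  have "image_mset Suc (image_mset (Poly_Mapping.lookup b) (mset_set ?K)) = exponents m"
    unfolding exponents_def image_mset.compositionality
    by (rule image_mset_cong) (simp add: b in_keys_iff)
  then have "mset (map Suc (sorted_list_of_multiset (exponents b) @ replicate (r - size (exponents b)) 0)) = exponents m"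
    by (simp add: split)
  moreover have "{#x \<in># exponents m. x \<noteq> 0#} = exponents m"
    by (auto simp: filter_mset_eq_conv exponents_def in_keys_iff)
  ultimately have eq: "exponents (Poly_Mapping.nth (map Suc (sorted_list_of_multiset (exponents b) @
      replicate (r - size (exponents b)) 0))) = exponents m"
    by (simp only: exponents_nth)
  show ?thesis
    unfolding lower_def using le symmetric_exponents[OF f eq] by (simp only: if_True)
qed

lemma elem_sym_smult:
  assumes f: "symmetric f" and r: "card (Poly_Mapping.keys m) \<le> r"
  shows "smult (elem_sym r) (lower r f) m = (if card (Poly_Mapping.keys m) = r then f m else 0)"
proof -
  let ?K = "Poly_Mapping.keys m"
  \<comment> \<open>A squarefree factor of degree \<open>r\<close> of a monomial in at most
    \<open>r\<close> variables must be the product of all its variables.\<close>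
  have sq: "a = (\<Sum>i\<in>?K. Poly_Mapping.single i 1) \<and> card ?K = r"
    if "a + b = m" "elem_sym r a \<noteq> 0" for a b
  proof -
    have a: "deg a = r" "Poly_Mapping.lookup a i \<le> 1" for i
      using that(2) by (auto simp: elem_sym_def split: if_splits)
    have sub: "Poly_Mapping.keys a \<subseteq> ?K" using that(1) by (auto simp: in_keys_iff lookup_add)
    have one: "Poly_Mapping.lookup a i = 1" if "i \<in> Poly_Mapping.keys a" for i
      using a(2)[of i] that by (simp add: in_keys_iff)
    then have card: "card (Poly_Mapping.keys a) = r" using a(1) by (simp add: deg_def)
    then have eq: "Poly_Mapping.keys a = ?K" using card_seteq[OF finite_keys sub] r by simp
    have "a = (\<Sum>i\<in>?K. Poly_Mapping.single i 1)"
    proof (rule poly_mapping_eqI)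
      fix i
      show "Poly_Mapping.lookup a i = Poly_Mapping.lookup (\<Sum>i\<in>?K. Poly_Mapping.single i 1) i"
        using one[of i] eq by (cases "i \<in> ?K") (auto simp: lookup_sum lookup_single when_def in_keys_iff)
    qed
    then show ?thesis using card eq by simp
  qed
  show ?thesis
  proof (cases "card ?K = r")
    case False
    then have "elem_sym r a * lower r f b = 0" if "a + b = m" for a b
      using sq[OF that] by auto
    then show ?thesis using False unfolding smult_def by (auto intro!: sum.neutral)
  next
    case True
    define a where "a = (\<Sum>i\<in>?K. Poly_Mapping.single i (1 :: nat))"
    define b where "b = m - a"
    have look: "Poly_Mapping.lookup a i = (if i \<in> ?K then 1 else 0)" for i
      by (auto simp: a_def lookup_sum lookup_single when_def)
    have ab: "a + b = m"
      by (rule poly_mapping_eqI) (auto simp: b_def lookup_add lookup_minus look in_keys_iff)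
    have keys: "Poly_Mapping.keys a = ?K" by (auto simp: in_keys_iff look split: if_splits)
    have "elem_sym r a = 1"
      using True by (simp add: elem_sym_def deg_def keys look)
    moreover have "lower r f b = f m"
      by (rule lower_eq[OF f True]) (auto simp: b_def lookup_minus look in_keys_iff)
    moreover have "smult (elem_sym r) (lower r f) m = (\<Sum>(a, b)\<in>{(a, b)}. elem_sym r a * lower r f b)"
      unfolding smult_def
    proof (rule sum.mono_neutral_right)
      show "finite {(a, b). a + b = m}"
        using bij_betw_finite[OF splits_bij[of "exponent_list m"]] by (simp add: finite_splits)
      have "a' = a \<and> b' = b" if "a' + b' = m" "elem_sym r a' \<noteq> 0" for a' b'
      proof -
        have "a' = a" using sq[OF that] by (simp only: a_def)
        then show ?thesis using that(1) ab by (metis add_left_cancel)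
      qed
      then show "\<forall>x\<in>{(a, b). a + b = m} - {(a, b)}. (case x of (a, b) \<Rightarrow> elem_sym r a * lower r f b) = 0"
        by auto
    qed (use ab in auto)
    ultimately show ?thesis using True by simp
  qed
qed

text \<open>Lexicographic induction on the degree bound \<open>d\<close> and the gap
  \<open>Suc d - r\<close>: a monomial has at most as many variables as its degree, so only the zero
  series remains once \<open>r > d\<close>.\<close>

lemma Sym_induct_aux:
  assumes one: "Q \<one>\<^bsub>Sym\<^esub>" and elem: "\<And>k. Q (elem_sym k)"
    and add: "\<And>f g. f \<in> carrier Sym \<Longrightarrow> g \<in> carrier Sym \<Longrightarrow> Q f \<Longrightarrow> Q g \<Longrightarrow> Q (\<lambda>m. f m + g m)"
    and diff: "\<And>f g. f \<in> carrier Sym \<Longrightarrow> g \<in> carrier Sym \<Longrightarrow> Q f \<Longrightarrow> Q g \<Longrightarrow> Q (\<lambda>m. f m - g m)"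
    and mult: "\<And>f g. f \<in> carrier Sym \<Longrightarrow> g \<in> carrier Sym \<Longrightarrow> Q f \<Longrightarrow> Q g \<Longrightarrow> Q (smult f g)"
    and f: "symmetric f" "\<And>m. f m \<noteq> 0 \<Longrightarrow> deg m \<le> d \<and> r \<le> card (Poly_Mapping.keys m)"
  shows "Q f"
  using f
proof (induction "(d, Suc d - r)" arbitrary: d r f rule: wf_induct_rule[OF wf_lex_prod[OF wf_less_than wf_less_than]])
  case (1 d r f)
  have carrier: "f \<in> carrier Sym" using 1(2,3) by (auto simp: Sym_simps bounded_degree_def)
  \<comment> \<open>Integer constants come from repeatedly adding or subtracting 1, starting at
    \<open>1 - 1\<close>.\<close>
  have const: "(\<lambda>m. if m = 0 then c else 0) \<in> carrier Sym \<and> Q (\<lambda>m. if m = 0 then c else 0)" for c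
  proof (induction c rule: int_induct[of _ 0])
    case base
    have "(\<lambda>m. if m = 0 then 0 else 0) = (\<lambda>m. \<one>\<^bsub>Sym\<^esub> m - \<one>\<^bsub>Sym\<^esub> m)" by simp
    then show ?case using diff[OF Sym_one Sym_one one one] Sym_diff[OF Sym_one Sym_one] by metis
  next
    case (step1 i)
    have eq: "(\<lambda>m. if m = 0 then i + 1 else 0) = (\<lambda>m. (if m = 0 then i else 0) + \<one>\<^bsub>Sym\<^esub> m)"
      by (auto simp: Sym_simps)
    show ?case unfolding eq using step1 add[OF _ Sym_one _ one] Sym_add[OF _ Sym_one] by blast
  next
    case (step2 i)
    have eq: "(\<lambda>m. if m = 0 then i - 1 else 0) = (\<lambda>m. (if m = 0 then i else 0) - \<one>\<^bsub>Sym\<^esub> m)"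
      by (auto simp: Sym_simps)
    show ?case unfolding eq using step2 diff[OF _ Sym_one _ one] Sym_diff[OF _ Sym_one] by blast
  qed
  have IH: "Q g" if "symmetric g" "\<And>m. g m \<noteq> 0 \<Longrightarrow> deg m \<le> d' \<and> r' \<le> card (Poly_Mapping.keys m)"
    "d' < d \<or> d' = d \<and> r < r' \<and> r \<le> d" for g d' r'
    by (rule 1(1)[OF _ that(1,2)]) (use that(3) in auto)
  consider "r > d" | "r = 0" | "0 < r" "r \<le> d" by linarith
  then show ?case
  proof cases
    case 1
    have "f m = 0" for m
      using "1.prems"(2)[of m] 1 size_exponents_le_deg[of m] by (force simp: card_keys_exponents)
    then have "f = (\<lambda>m. if m = 0 then 0 else 0)" by (simp add: fun_eq_iff)
    then show ?thesis using const[of 0] by simp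
  next
    case 2
    \<comment> \<open>For \<open>r = 0\<close> the factor \<open>elem_sym 0\<close> would not lower
      the degree, so the constant term is removed directly.\<close>
    define c :: pseries where "c = (\<lambda>m. if m = 0 then f 0 else 0)"
    have c: "c \<in> carrier Sym" "Q c" using const[of "f 0"] by (simp_all add: c_def)
    have fc: "(\<lambda>m. f m - c m) \<in> carrier Sym" by (rule Sym_diff[OF carrier c(1)])
    have "deg m \<le> d \<and> 1 \<le> card (Poly_Mapping.keys m)" if "f m - c m \<noteq> 0" for m
      using that "1.prems"(2)[of m] by (cases "m = 0") (auto simp: c_def Suc_le_eq card_gt_0_iff)
    then have "Q (\<lambda>m. f m - c m)"
      using fc 2 by (intro IH[of _ d 1]) (auto simp: Sym_simps)
    from add[OF fc c(1) this c(2)] show ?thesis by simp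
  next
    case 3
    define g where "g = lower r f"
    have deg_g: "deg m \<le> d - r" if "g m \<noteq> 0" for m
      using deg_lower[of f d r m] "1.prems"(2) that by (force simp: g_def)
    have g: "g \<in> carrier Sym"
      using symmetric_lower[of r f] deg_g unfolding Sym_simps bounded_degree_def g_def[symmetric] by blast
    have "Q g"
      by (rule IH[of _ "d - r" 0]) (use deg_g 3 in \<open>auto simp: g_def symmetric_lower\<close>)
    define p where "p = smult (elem_sym r) g"
    have p: "p \<in> carrier Sym" "Q p"
      using Sym_smult[OF elem_sym_Sym g] mult[OF elem_sym_Sym g elem \<open>Q g\<close>] by (simp_all add: p_def)
    have fp: "(\<lambda>m. f m - p m) \<in> carrier Sym" by (rule Sym_diff[OF carrier p(1)])
    have "deg m \<le> d \<and> Suc r \<le> card (Poly_Mapping.keys m)" if m: "f m - p m \<noteq> 0" for m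
    proof
      have "deg m \<le> d" if pm: "p m \<noteq> 0"
      proof -
        obtain a b where "a + b = m" "elem_sym r a \<noteq> 0" "g b \<noteq> 0"
          using smult_nonzero[OF pm[unfolded p_def]] by blast
        then show ?thesis using deg_g[of b] 3 by (auto simp: deg_add elem_sym_def split: if_splits)
      qed
      then show "deg m \<le> d" using m "1.prems"(2)[of m] by fastforce
      show "Suc r \<le> card (Poly_Mapping.keys m)"
      proof (rule ccontr)
        assume neg: "\<not> Suc r \<le> card (Poly_Mapping.keys m)"
        then have "p m = (if card (Poly_Mapping.keys m) = r then f m else 0)"
          unfolding p_def g_def by (intro elem_sym_smult "1.prems"(1)) simp
        then show False using m "1.prems"(2)[of m] neg by (auto split: if_splits)
      qed
    qed
    then have "Q (\<lambda>m. f m - p m)"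
      using fp 3 by (intro IH[of _ d "Suc r"]) (auto simp: Sym_simps)
    from add[OF fp p(1) this p(2)] show ?thesis by simp
  qed
qed

lemma Sym_induct [consumes 1, case_names one elem add diff mult]:
  assumes "f \<in> carrier Sym"
    and "Q \<one>\<^bsub>Sym\<^esub>" "\<And>k. Q (elem_sym k)"
    and "\<And>f g. f \<in> carrier Sym \<Longrightarrow> g \<in> carrier Sym \<Longrightarrow> Q f \<Longrightarrow> Q g \<Longrightarrow> Q (\<lambda>m. f m + g m)"
    and "\<And>f g. f \<in> carrier Sym \<Longrightarrow> g \<in> carrier Sym \<Longrightarrow> Q f \<Longrightarrow> Q g \<Longrightarrow> Q (\<lambda>m. f m - g m)"
    and "\<And>f g. f \<in> carrier Sym \<Longrightarrow> g \<in> carrier Sym \<Longrightarrow> Q f \<Longrightarrow> Q g \<Longrightarrow> Q (smult f g)"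
  shows "Q f"
proof -
  obtain d where "\<And>m. f m \<noteq> 0 \<Longrightarrow> deg m \<le> d"
    using assms(1) by (auto simp: Sym_simps bounded_degree_def)
  then show ?thesis
    using assms by (intro Sym_induct_aux[of Q f d 0]) (auto simp: Sym_simps(1))
qed

text \<open>Evaluates the definite description: \<open>omega_fun\<close> meets the conditions, and
  two homomorphisms that agree on the elementary functions agree by \<open>Sym_induct\<close>. The
  restriction accounts for \<open>extensional\<close>.\<close>

lemma omega_Sym_eq: "omega_Sym = restrict omega_fun (carrier Sym)"
proof -
  let ?P = "\<lambda>\<phi>. \<phi> \<in> ring_hom Sym Sym \<and> \<phi> \<in> extensional (carrier Sym) \<and>
     (\<forall>f\<in>carrier Sym. \<phi> (\<phi> f) = f) \<and> (\<forall>k. \<phi> (elem_sym k) = complete_sym k)"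
  let ?w = "restrict omega_fun (carrier Sym)"
  have sym: "f \<in> carrier Sym \<Longrightarrow> symmetric f" for f by (simp add: Sym_simps)
  have hom: "?w \<in> ring_hom Sym Sym"
  proof (rule ring_hom_memI)
    show "?w \<one>\<^bsub>Sym\<^esub> = \<one>\<^bsub>Sym\<^esub>"
      using omega_fun_elem_sym[of 0] by (simp add: Sym_one elem_sym_0 complete_sym_0)
  qed (simp_all add: Sym_simps(2,4) omega_fun_Sym Sym_smult omega_fun_smult sym Sym_add omega_fun_add)
  have w: "?P ?w"
    using hom by (auto simp: omega_fun_Sym omega_fun_omega_fun sym elem_sym_Sym omega_fun_elem_sym)
  show ?thesis
    unfolding omega_Sym_def
  proof (rule the_equality)
    show "?P ?w" by (rule w)
  next
    fix \<phi> assume \<phi>: "?P \<phi>"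
    \<comment> \<open>Homomorphisms are given on sums, products and one; differences follow from
      \<open>f = (f - g) + g\<close>.\<close>
    have hom_diff: "\<psi> (\<lambda>m. f m - g m) = (\<lambda>m. \<psi> f m - \<psi> g m)"
      if "\<psi> \<in> ring_hom Sym Sym" "f \<in> carrier Sym" "g \<in> carrier Sym" for \<psi> f g
    proof -
      have "\<psi> f = (\<lambda>m. \<psi> (\<lambda>m. f m - g m) m + \<psi> g m)"
        using ring_hom_add[OF that(1) Sym_diff[OF that(2,3)] that(3)] by (simp add: Sym_simps(4))
      then show ?thesis by (simp add: fun_eq_iff)
    qed
    have hom_add: "\<psi> (\<lambda>m. f m + g m) = (\<lambda>m. \<psi> f m + \<psi> g m)" and hom_mult: "\<psi> (smult f g) = smult (\<psi> f) (\<psi> g)"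
      if "\<psi> \<in> ring_hom Sym Sym" "f \<in> carrier Sym" "g \<in> carrier Sym" for \<psi> f g
      using ring_hom_add[OF that] ring_hom_mult[OF that] by (simp_all add: Sym_simps(2,4))
    from \<phi> have \<phi>_hom: "\<phi> \<in> ring_hom Sym Sym" by (rule conjunct1)
    have "\<phi> f = ?w f" if "f \<in> carrier Sym" for f
      using that
    proof (induction rule: Sym_induct)
      case one
      then show ?case by (simp only: ring_hom_one[OF \<phi>_hom] ring_hom_one[OF hom])
    next
      case (elem k)
      then show ?case using \<phi> w by simp
    next
      case (add f g)
      then show ?case by (simp only: hom_add[OF \<phi>_hom add(1,2)] hom_add[OF hom add(1,2)])
    next
      case (diff f g)
      then show ?case by (simp only: hom_diff[OF \<phi>_hom diff(1,2)] hom_diff[OF hom diff(1,2)])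
    next
      case (mult f g)
      then show ?case by (simp only: hom_mult[OF \<phi>_hom mult(1,2)] hom_mult[OF hom mult(1,2)])
    qed
    then show "\<phi> = ?w"
      using \<phi> by (intro extensionalityI[of _ "carrier Sym"]) auto
  qed
qed

lemma symmetric_homogeneous_part:
  assumes "symmetric f"
  shows "homogeneous_part d f \<in> carrier Sym"
proof -
  have "symmetric (homogeneous_part d f)"
  proof (rule symmetricI)
    fix m m' assume eq: "exponents m = exponents m'"
    show "homogeneous_part d f m = homogeneous_part d f m'"
      using symmetric_exponents[OF assms eq] eq by (simp add: homogeneous_part_def deg_exponents)
  qed
  then show ?thesis by (auto simp: Sym_simps bounded_degree_def homogeneous_part_def)
qed

lemma omega_eq:
  assumes "symmetric f"
  shows "omega f = omega_fun f"
proof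
  fix m
  have "omega f m = Sum_any (\<lambda>d. if deg m = d then omega_fun f m else 0)"
    by (simp add: omega_def omega_Sym_eq symmetric_homogeneous_part assms omega_fun_homogeneous_part)
  also have "\<dots> = (\<Sum>d\<in>{deg m}. if deg m = d then omega_fun f m else 0)"
    by (rule Sum_any.expand_superset) auto
  finally show "omega f m = omega_fun f m" by simp
qed

section \<open>Partitions as order ideals, and the two tableau series compared\<close>

lemma order_ideal_diagram:
  assumes "is_partition ps"
  shows "order_ideal (diagram ps)"
  unfolding order_ideal_def
proof (intro allI impI)
  fix i j i' j' assume "(i, j) \<in> diagram ps" "i' \<le> i" "j' \<le> j"
  moreover from this have "ps ! i \<le> ps ! i'"
    using assms sorted_wrt_nth_less[of "(\<ge>)" ps i' i] by (cases "i' = i") (auto simp: is_partition_def diagram_def)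
  ultimately show "(i', j') \<in> diagram ps" by (auto simp: diagram_def)
qed

theorem proposition9p22:
  fixes lam nu :: "nat list"
  assumes "is_partition lam" and "is_partition nu" and "diagram nu \<subseteq> diagram lam"
  shows "omega (K_tilde lam nu) = J_weak lam nu"
proof -
  \<comment> \<open>A common bound for rows and columns: there are \<open>length lam\<close> rows,
    none longer than \<open>sum_list lam\<close>.\<close>
  interpret skew_states "diagram nu" "diagram lam" "length lam + sum_list lam"
  proof
    show "diagram lam \<subseteq> {..<length lam + sum_list lam} \<times> {..<length lam + sum_list lam}"
      using member_le_sum_list[OF nth_mem, of _ lam] by (force simp: diagram_def)
  qed (use assms order_ideal_diagram in auto)
  have lam: "diagram lam \<in> states"
    using assms order_ideal_diagram by (auto simp: states_def)
  have K: "list_series (K_tilde lam nu) as = strip_word as (diagram lam)" for as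
  proof -
    have "list_series (K_tilde lam nu) as = strip_word (rev as) (diagram lam)"
      using K_tabs_card[OF lam, of as] by (simp add: list_series_def K_tilde_def K_tabs_def skew_def)
    \<comment> \<open>Removing the largest letter first reads the list backwards; symmetry of the
      words undoes the reversal.\<close>
    moreover have "mset (rev as) = mset as" by simp
    ultimately show ?thesis using sym_list_strip_word[of "diagram lam"] unfolding sym_list_def by metis
  qed
  have "K_tilde lam nu m = strip_word (exponent_list m) (diagram lam)" for m
    using K[of "exponent_list m"] by (simp add: list_series_exponent_list)
  then have "K_tilde lam nu = (\<lambda>m. strip_word (exponent_list m) (diagram lam))" by (rule ext)
  then have "symmetric (K_tilde lam nu)"
    using symmetric_exponent_list[OF sym_list_strip_word, of "diagram lam"] by simp
  then have "omega (K_tilde lam nu) m = omega_list (\<lambda>as. strip_word as (diagram lam)) (exponent_list m)" for m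
    by (simp add: omega_eq omega_fun_def K[abs_def])
  \<comment> \<open>The weak count is reversed as well; here the symmetry of
    \<open>omega_list\<close> compensates.\<close>
  moreover have "omega_list (\<lambda>as. strip_word as (diagram lam)) ns = omega_list (\<lambda>as. strip_word as (diagram lam)) (rev ns)" for ns
  proof -
    have "mset ns = mset (rev ns)" by simp
    then show ?thesis using sym_list_omega_list[OF sym_list_strip_word] unfolding sym_list_def by blast
  qed
  moreover have "J_weak lam nu m = weak_word (rev (exponent_list m)) (diagram lam)" for m
  proof -
    have "list_series (J_weak lam nu) as = weak_word (rev as) (diagram lam)" for as
      using J_tabs_card[OF lam, of as] by (simp add: list_series_def J_weak_def J_tabs_def skew_def)
    then show ?thesis by (metis list_series_exponent_list)
  qed
  ultimately show ?thesis by (metis ext omega_list_strip_word)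
qed

end
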